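(* If the unimodular solvable real Lie algebra $\mathfrak{g}$ admits a Vaisman structure, then for every $x\in\mathfrak{g}$ all (complex) eigenvalues of the operator $\operatorname{ad}_x:\mathfrak{g}\to\mathfrak{g}$ are imaginary, i.e. lie in $i\mathbb{R}$ (some of them are $0$).
   Context: All Lie algebras are finite-dimensional. A Lie algebra is unimodular if $\operatorname{tr}(\operatorname{ad}_x)=0$ for all $x$. $d$ denotes the Chevalley–Eilenberg differential. A complex structure on $\mathfrak{g}$ is an endomorphism $J$ with $J^2=-\mathrm{Id}$ and $[Jx,Jy]-[x,y]-J([Jx,y]+[x,Jy])=0$ for all $x,y$. Given a Hermitian inner product $\langle\cdot,\cdot\rangle$ (i.e. $\langle Jx,Jy\rangle=\langle x,y\rangle$), the fundamental $2$-form is $\omega(x,y)=\langle Jx,y\rangle$. $(J,\langle\cdot,\cdot\rangle)$ is an LCK structure on $\mathfrak{g}$ if there is $\theta\in\mathfrak{g}^*$ (the Lee form) with $d\theta=0$ and $d\omega=\theta\wedge\omega$; it is Vaisman if moreover $\nabla\theta=0$, where $\nabla$ is the Levi-Civita connection, given by $\langle\nabla_xy,z\rangle=\frac12(\langle[x,y],z\rangle-\langle[y,z],x\rangle+\langle[z,x],y\rangle)$. The Lee form of a Vaisman structure is assumed to be nonzero. *)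

theory Defs
  imports "HOL-Analysis.Analysis"
begin

section \<open>Traces and complex eigenvalues of real endomorphisms\<close>

definition finite_dim :: "'a::real_vector itself \<Rightarrow> bool" where
  "finite_dim _ \<longleftrightarrow> (\<exists>B::'a set. finite B \<and> span B = UNIV)"

text \<open>
  \<open>extend_basis {}\<close> is the library's chosen basis of the whole space.  On a finite-dimensional
  space the choice does not matter, see \<open>op_trace_eq\<close> below.
\<close>

definition op_trace :: "('a::real_vector \<Rightarrow> 'a) \<Rightarrow> real" where
  "op_trace f = (\<Sum>b\<in>extend_basis {}. representation (extend_basis {}) (f b) b)"

text \<open>
  The complexification of a real vector space is modelled on pairs, with \<open>(u, v)\<close> standing for
  \<open>u + \<i> v\<close>; the operator \<open>f\<close> extends complex-linearly as \<open>map_prod f f\<close>.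
\<close>

definition cscale :: "complex \<Rightarrow> 'a::real_vector \<times> 'a \<Rightarrow> 'a \<times> 'a" where
  "cscale \<mu> w = (Re \<mu> *\<^sub>R fst w - Im \<mu> *\<^sub>R snd w, Re \<mu> *\<^sub>R snd w + Im \<mu> *\<^sub>R fst w)"

definition complex_eigenvalue :: "('a::real_vector \<Rightarrow> 'a) \<Rightarrow> complex \<Rightarrow> bool" where
  "complex_eigenvalue f \<mu> \<longleftrightarrow> (\<exists>w. w \<noteq> 0 \<and> map_prod f f w = cscale \<mu> w)"


section \<open>Lie algebras\<close>

text \<open>The Lie algebra is the whole type; \<open>br x\<close> is the operator \<open>ad\<^sub>x\<close>.\<close>

locale real_lie_algebra =
  fixes br :: "'a::real_vector \<Rightarrow> 'a \<Rightarrow> 'a"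
  assumes finite_dim: "finite_dim TYPE('a)"
    and bilinear: "bilinear br"
    and alternating: "br x x = 0"
    and jacobi: "br x (br y z) + br y (br z x) + br z (br x y) = 0"

definition unimodular :: "('a::real_vector \<Rightarrow> 'a \<Rightarrow> 'a) \<Rightarrow> bool" where
  "unimodular br \<longleftrightarrow> (\<forall>x. op_trace (br x) = 0)"

primrec derived_series :: "('a::real_vector \<Rightarrow> 'a \<Rightarrow> 'a) \<Rightarrow> nat \<Rightarrow> 'a set" where
  "derived_series br 0 = UNIV"
| "derived_series br (Suc n) =
     span {br x y | x y. x \<in> derived_series br n \<and> y \<in> derived_series br n}"

definition solvable :: "('a::real_vector \<Rightarrow> 'a \<Rightarrow> 'a) \<Rightarrow> bool" where
  "solvable br \<longleftrightarrow> (\<exists>n. derived_series br n = {0})"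

text \<open>The Chevalley--Eilenberg differential (trivial coefficients) in degrees 1 and 2.\<close>

definition ce_d1 :: "('a \<Rightarrow> 'a \<Rightarrow> 'a) \<Rightarrow> ('a::real_vector \<Rightarrow> real) \<Rightarrow> 'a \<Rightarrow> 'a \<Rightarrow> real" where
  "ce_d1 br \<alpha> x y = - \<alpha> (br x y)"

definition ce_d2 ::
    "('a \<Rightarrow> 'a \<Rightarrow> 'a) \<Rightarrow> ('a::real_vector \<Rightarrow> 'a \<Rightarrow> real) \<Rightarrow> 'a \<Rightarrow> 'a \<Rightarrow> 'a \<Rightarrow> real" where
  "ce_d2 br \<omega> x y z = - \<omega> (br x y) z + \<omega> (br x z) y - \<omega> (br y z) x"

definition wedge12 ::
    "('a::real_vector \<Rightarrow> real) \<Rightarrow> ('a \<Rightarrow> 'a \<Rightarrow> real) \<Rightarrow> 'a \<Rightarrow> 'a \<Rightarrow> 'a \<Rightarrow> real" where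
  "wedge12 \<theta> \<omega> x y z = \<theta> x * \<omega> y z - \<theta> y * \<omega> x z + \<theta> z * \<omega> x y"


section \<open>Hermitian, LCK and Vaisman structures\<close>

definition complex_structure :: "('a::real_vector \<Rightarrow> 'a \<Rightarrow> 'a) \<Rightarrow> ('a \<Rightarrow> 'a) \<Rightarrow> bool" where
  "complex_structure br J \<longleftrightarrow> linear J \<and> (\<forall>x. J (J x) = - x) \<and>
     (\<forall>x y. br (J x) (J y) - br x y - J (br (J x) y + br x (J y)) = 0)"

definition inner_product :: "('a::real_vector \<Rightarrow> 'a \<Rightarrow> real) \<Rightarrow> bool" where
  "inner_product ip \<longleftrightarrow> bilinear ip \<and> (\<forall>x y. ip x y = ip y x) \<and> (\<forall>x. x \<noteq> 0 \<longrightarrow> ip x x > 0)"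

definition hermitian :: "('a::real_vector \<Rightarrow> 'a) \<Rightarrow> ('a \<Rightarrow> 'a \<Rightarrow> real) \<Rightarrow> bool" where
  "hermitian J ip \<longleftrightarrow> inner_product ip \<and> (\<forall>x y. ip (J x) (J y) = ip x y)"

definition fundamental_form ::
    "('a::real_vector \<Rightarrow> 'a) \<Rightarrow> ('a \<Rightarrow> 'a \<Rightarrow> real) \<Rightarrow> 'a \<Rightarrow> 'a \<Rightarrow> real" where
  "fundamental_form J ip x y = ip (J x) y"

definition lck_structure :: "('a::real_vector \<Rightarrow> 'a \<Rightarrow> 'a) \<Rightarrow> ('a \<Rightarrow> 'a) \<Rightarrow>
    ('a \<Rightarrow> 'a \<Rightarrow> real) \<Rightarrow> ('a \<Rightarrow> real) \<Rightarrow> bool" where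
  "lck_structure br J ip \<theta> \<longleftrightarrow> complex_structure br J \<and> hermitian J ip \<and> linear \<theta> \<and>
     (\<forall>x y. ce_d1 br \<theta> x y = 0) \<and>
     (\<forall>x y z. ce_d2 br (fundamental_form J ip) x y z = wedge12 \<theta> (fundamental_form J ip) x y z)"

text \<open>
  \<open>levi_civita br ip x y\<close> is \<open>\<nabla>\<^sub>x y\<close>; existence and uniqueness are recorded in
  \<open>levi_civita_koszul\<close> below.
\<close>

definition levi_civita ::
    "('a::real_vector \<Rightarrow> 'a \<Rightarrow> 'a) \<Rightarrow> ('a \<Rightarrow> 'a \<Rightarrow> real) \<Rightarrow> 'a \<Rightarrow> 'a \<Rightarrow> 'a" where
  "levi_civita br ip x y =
     (THE v. \<forall>z. ip v z = (ip (br x y) z - ip (br y z) x + ip (br z x) y) / 2)"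

text \<open>
  For a left-invariant 1-form \<open>\<theta> y\<close> is constant for left-invariant \<open>y\<close>, so
  \<open>(\<nabla>\<^sub>x \<theta>) y = - \<theta> (\<nabla>\<^sub>x y)\<close>.
\<close>

definition nabla_form :: "('a::real_vector \<Rightarrow> 'a \<Rightarrow> 'a) \<Rightarrow> ('a \<Rightarrow> 'a \<Rightarrow> real) \<Rightarrow>
    ('a \<Rightarrow> real) \<Rightarrow> 'a \<Rightarrow> 'a \<Rightarrow> real" where
  "nabla_form br ip \<theta> x y = - \<theta> (levi_civita br ip x y)"

definition vaisman_structure ::
    "('a::real_vector \<Rightarrow> 'a \<Rightarrow> 'a) \<Rightarrow> ('a \<Rightarrow> 'a) \<Rightarrow> ('a \<Rightarrow> 'a \<Rightarrow> real) \<Rightarrow> bool" where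
  "vaisman_structure br J ip \<longleftrightarrow>
     (\<exists>\<theta>. lck_structure br J ip \<theta> \<and> (\<forall>x y. nabla_form br ip \<theta> x y = 0) \<and> (\<exists>x. \<theta> x \<noteq> 0))"


section \<open>Well-definedness of the trace and of the connection\<close>

lemma finite_basis:
  fixes B :: "'a::real_vector set"
  assumes "finite_dim TYPE('a)" "independent B"
  shows "finite B"
  using assms independent_span_bound[of _ B] unfolding finite_dim_def by auto

lemma op_trace_eq:
  fixes f :: "'a::real_vector \<Rightarrow> 'a"
  assumes fd: "finite_dim TYPE('a)" and f: "linear f"
    and B: "independent B" "span B = UNIV"
  shows "op_trace f = (\<Sum>b\<in>B. representation B (f b) b)"
proof -
  define C :: "'a set" where "C = extend_basis {}"
  have C: "independent C" "span C = UNIV"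
    using independent_extend_basis[OF independent_empty, where 'a='a]
      span_extend_basis[OF independent_empty, where 'a='a] by (simp_all add: C_def)
  have fin: "finite B" "finite C"
    using finite_basis[OF fd] B C by auto
  have expand: "representation D (g v) d = (\<Sum>e\<in>E. representation E v e * representation D (g e) d)"
    if g: "linear g" and "independent D" "span D = UNIV" "independent E" "span E = UNIV" "finite E"
    for D E :: "'a set" and g v d
  proof -
    have v: "v = (\<Sum>e\<in>E. representation E v e *\<^sub>R e)"
      using sum_representation_eq[of E v E] that by simp
    have lin: "linear (\<lambda>v. representation D (g v) d)"
      using representation_add[of D] representation_scale[of D] that(2,3)
      by (intro linearI) (simp_all add: linear_add[OF g] linear_scale[OF g])
    show ?thesis
      by (subst v) (simp add: linear_sum[OF lin] linear_scale[OF lin])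
  qed
  have "op_trace f = (\<Sum>c\<in>C. representation C (f c) c)"
    by (simp add: op_trace_def C_def)
  also have "\<dots> = (\<Sum>c\<in>C. \<Sum>b\<in>B. representation B c b * representation C (f b) c)"
    by (intro sum.cong refl expand f C B fin)
  also have "\<dots> = (\<Sum>b\<in>B. \<Sum>c\<in>C. representation C (f b) c * representation B c b)"
    by (subst sum.swap) (simp add: mult.commute)
  also have "\<dots> = (\<Sum>b\<in>B. representation B (f b) b)"
    by (intro sum.cong refl expand[symmetric, OF linear_ident] C B fin)
  finally show ?thesis .
qed

lemma inner_product_riesz:
  fixes \<phi> :: "'a::real_vector \<Rightarrow> real"
  assumes fd: "finite_dim TYPE('a)" and ip: "inner_product ip" and \<phi>: "linear \<phi>"
  shows "\<exists>!v. \<forall>z. ip v z = \<phi> z"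
proof -
  have bil: "bilinear ip" and sym: "ip x y = ip y x" and pos: "x \<noteq> 0 \<Longrightarrow> ip x x > 0" for x y
    using ip by (auto simp: inner_product_def)
  note bl = bilinear_ladd[OF bil] bilinear_radd[OF bil] bilinear_lmul[OF bil]
    bilinear_rmul[OF bil] bilinear_lsub[OF bil] bilinear_rsub[OF bil]
  have ex: "\<exists>v\<in>span B. \<forall>z\<in>span B. ip v z = \<psi> z"
    if "finite B" "linear \<psi>" for B and \<psi> :: "'a \<Rightarrow> real"
    using that
  proof (induction B arbitrary: \<psi> rule: finite_induct)
    case empty
    then show ?case
      using bilinear_lzero[OF bil] by (simp add: linear_0)
  next
    case (insert b B)
    obtain v where v: "v \<in> span B" "\<And>z. z \<in> span B \<Longrightarrow> ip v z = \<psi> z"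
      using insert.IH[OF insert.prems] by blast
    have "linear (ip b)"
      using bil by (simp add: bilinear_def)
    then obtain w where w: "w \<in> span B" "\<And>z. z \<in> span B \<Longrightarrow> ip w z = ip b z"
      using insert.IH by blast
    show ?case
    proof (cases "b \<in> span B")
      case True
      then show ?thesis
        using v by (auto simp: span_redundant)
    next
      case False
      define u where "u = b - w"
      have u0: "ip u u \<noteq> 0"
        using False w(1) pos[of u] by (cases "u = 0") (auto simp: u_def)
      have orth: "ip u z = 0" if "z \<in> span B" for z
        using w(2)[OF that] by (simp add: u_def bl)
      define v' where "v' = v + (\<psi> u / ip u u) *\<^sub>R u"
      have sub: "span B \<subseteq> span (insert b B)"
        by (intro span_mono) auto
      have uin: "u \<in> span (insert b B)"
        unfolding u_def using span_diff[OF span_base[of b "insert b B"] subsetD[OF sub w(1)]] by simp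
      have "v' \<in> span (insert b B)"
        using uin sub v(1) by (auto simp: v'_def intro!: span_add span_scale)
      moreover have "ip v' z = \<psi> z" if z: "z \<in> span (insert b B)" for z
      proof -
        obtain k where k: "z - k *\<^sub>R b \<in> span B"
          using z span_breakdown_eq by blast
        define s where "s = (z - k *\<^sub>R b) + k *\<^sub>R w"
        have s: "s \<in> span B"
          using k w(1) by (auto simp: s_def intro!: span_add[of "z - k *\<^sub>R b"] span_scale)
        have zs: "z = s + k *\<^sub>R u"
          by (simp add: s_def u_def algebra_simps)
        have "ip v u = 0"
          using orth[OF v(1)] sym by metis
        then show ?thesis
          using u0 by (simp add: zs v'_def bl v(2)[OF s] orth[OF s]
              linear_add[OF insert.prems] linear_scale[OF insert.prems])
      qed
      ultimately show ?thesis by blast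
    qed
  qed
  obtain B :: "'a set" where "finite B" "span B = UNIV"
    using fd by (auto simp: finite_dim_def)
  then obtain v where v: "\<forall>z. ip v z = \<phi> z"
    using ex[OF _ \<phi>, of B] by auto
  show ?thesis
  proof (rule ex1I[of _ v])
    show "\<forall>z. ip v z = \<phi> z" by (rule v)
    fix v' assume "\<forall>z. ip v' z = \<phi> z"
    then have "ip (v' - v) (v' - v) = 0"
      using v by (simp add: bl)
    then show "v' = v"
      using pos[of "v' - v"] by force
  qed
qed

lemma levi_civita_koszul:
  assumes "real_lie_algebra br" "inner_product ip"
  shows "ip (levi_civita br ip x y) z = (ip (br x y) z - ip (br y z) x + ip (br z x) y) / 2"
proof -
  interpret real_lie_algebra br by fact
  have bil: "bilinear ip"
    using assms(2) by (simp add: inner_product_def)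
  have "linear (\<lambda>z. (ip (br x y) z - ip (br y z) x + ip (br z x) y) / 2)"
    by (intro linearI)
      (simp_all add: bilinear_ladd[OF bil] bilinear_radd[OF bil] bilinear_lmul[OF bil]
        bilinear_rmul[OF bil] bilinear_ladd[OF bilinear] bilinear_radd[OF bilinear]
        bilinear_lmul[OF bilinear] bilinear_rmul[OF bilinear] field_simps)
  from theI'[OF inner_product_riesz[OF finite_dim assms(2) this]]
  show ?thesis
    by (simp add: levi_civita_def)
qed

end

theory Submission
  imports Defs
begin

text \<open>
  Let \<open>A\<close> be the vector dual to the Lee form and \<open>\<xi> = J A\<close>.  Parallelism makes \<open>ad A\<close> and
  \<open>ad \<xi>\<close> skew and \<open>J\<close>-linear.  Summing \<open>d\<omega> = \<theta> \<and> \<omega>\<close> over an orthonormal basis, unimodularity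
  gives \<open>\<Sum> [e, J e] = (dim - 2) \<xi>\<close>, so \<open>\<xi>\<close> lies in the derived algebra; solvability then gives
  \<open>tr (ad \<xi>)\<^sup>2 = 0\<close>, and as \<open>ad \<xi>\<close> is skew, \<open>\<xi>\<close> is central.  Dividing out \<open>\<xi>\<close> leaves a
  unimodular solvable Kaehler algebra.  The same sum is 0 there and forces the scalar curvature to
  vanish, while solvability exhibits it as minus a sum of squares.  Hence the derived algebra is
  abelian and every \<open>ad x\<close> acts on it by skew operators; eigenvectors for nonzero eigenvalues lie
  in (the complexification of) the derived algebra, so these eigenvalues are imaginary.
\<close>

section \<open>Commuting nilpotent operators\<close>

text \<open>Over the reals Lie's theorem itself, with its complex weights, is out of reach. For the
  Killing form it suffices that the derived algebra moves each ideal of some flag into the preceding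
  one. The next ideal comes from a nonzero vector of a quotient that the derived algebra kills, and
  Jacobson's lemma yields such a vector without any eigenvector.

  The scalar curvature becomes accessible because, in the Kaehler case, J commutes with the
  connection: tr(J R(x, y)) then loses its commutator part and reduces to -tr(J \<nabla>_[x, y]),
  which depends on [x, y] alone, so that \<Sum> [e, J e] = 0 settles the contraction. On a Vaisman
  algebra of dimension above 2, neither d\<omega> = 0 nor the vanishing of this sum holds; both are
  restored by dividing out the line of \<xi>. Since \<xi> is central, this cannot lose a nonzero
  eigenvalue.\<close>

lemma obtain_basis:
  assumes "finite_dim TYPE('a::real_vector)" "subspace (S::'a set)"
  obtains B where "independent B" "span B = S" "finite B"
proof -
  obtain B where B: "B \<subseteq> S" "independent B" "S \<subseteq> span B"
    using maximal_independent_subset[of S] by blast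
  moreover have "span B = S"
    using B span_minimal[OF B(1) assms(2)] by blast
  ultimately show thesis
    using that finite_basis[OF assms(1)] by blast
qed

text \<open>Finite dimension is a hypothesis on the type here, so the dimension theory is reached by
  interpreting its locale with a chosen finite basis.\<close>

lemma finite_dim_locale:
  fixes x :: "'a::real_vector"
  assumes "finite_dim TYPE('a)"
  obtains B :: "'a set" where "finite_dimensional_vector_space ((*\<^sub>R) :: real \<Rightarrow> 'a \<Rightarrow> 'a) B"
proof -
  obtain B :: "'a set" where B: "independent B" "span B = UNIV" "finite B"
    using obtain_basis[OF assms subspace_UNIV] by blast
  have "finite_dimensional_vector_space ((*\<^sub>R) :: real \<Rightarrow> 'a \<Rightarrow> 'a) B"
    using B by unfold_locales (auto simp: dependent_raw_def span_raw_def)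
  then show thesis
    by (rule that)
qed

text \<open>Trace of an operator on the subspace \<open>span B\<close> that it preserves, while
  \<open>op_trace\<close> refers to the whole space. Jacobson's lemma needs it on a stable
  image.\<close>

definition trace_on :: "'a::real_vector set \<Rightarrow> ('a \<Rightarrow> 'a) \<Rightarrow> real" where
  "trace_on B f = (\<Sum>b\<in>B. representation B (f b) b)"

lemma trace_on_comp_commute:
  assumes B: "independent B" "finite B" and f: "linear f" and g: "linear g"
    and fB: "f ` span B \<subseteq> span B" and gB: "g ` span B \<subseteq> span B"
  shows "trace_on B (\<lambda>v. f (g v)) = trace_on B (\<lambda>v. g (f v))"
proof -
  have expand: "representation B (h v) b = (\<Sum>c\<in>B. representation B v c * representation B (h c) b)"
    if h: "linear h" "h ` span B \<subseteq> span B" and v: "v \<in> span B" for h v b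
  proof -
    have *: "representation B (\<Sum>c\<in>C. k c *\<^sub>R h c) b = (\<Sum>c\<in>C. k c * representation B (h c) b)"
      if "finite C" "C \<subseteq> B" for C and k :: "'a \<Rightarrow> real"
      using that
    proof (induction C rule: finite_induct)
      case empty
      then show ?case by (simp add: representation_zero)
    next
      case (insert c C)
      have "k c *\<^sub>R h c \<in> span B" "(\<Sum>c\<in>C. k c *\<^sub>R h c) \<in> span B" "h c \<in> span B"
        using insert.prems h(2) span_base[of _ B] by (auto intro!: span_scale span_sum)
      then show ?case
        using insert by (simp add: representation_add representation_scale B(1))
    qed
    have "v = (\<Sum>c\<in>B. representation B v c *\<^sub>R c)"
      using sum_representation_eq[OF B(1) v B(2)] by simp
    then have "h v = (\<Sum>c\<in>B. representation B v c *\<^sub>R h c)"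
      by (metis (mono_tags, lifting) linear_sum[OF h(1)] linear_scale[OF h(1)] sum.cong)
    then show ?thesis
      using *[OF B(2)] by simp
  qed
  have "trace_on B (\<lambda>v. f (g v))
      = (\<Sum>b\<in>B. \<Sum>c\<in>B. representation B (g b) c * representation B (f c) b)"
    unfolding trace_on_def using gB span_base[of _ B] by (intro sum.cong refl expand f fB) auto
  also have "\<dots> = (\<Sum>c\<in>B. \<Sum>b\<in>B. representation B (f c) b * representation B (g b) c)"
    by (subst sum.swap) (simp add: mult.commute)
  also have "\<dots> = trace_on B (\<lambda>v. g (f v))"
    unfolding trace_on_def using fB span_base[of _ B]
    by (intro sum.cong refl expand[symmetric] g gB) auto
  finally show ?thesis .
qed

section \<open>Stable images, Jacobson's lemma and common kernels\<close>

lemma linear_funpow: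
  assumes "linear (f :: 'a::real_vector \<Rightarrow> 'a)"
  shows "linear (f ^^ n)"
proof (induction n)
  case 0
  then show ?case by (simp add: linear_id linear_ident id_def)
next
  case (Suc n)
  show ?case using linear_compose[OF Suc assms] by (simp only: funpow.simps)
qed

text \<open>The dimensions of the images of \<open>M\<close> under the powers of \<open>Z\<close>
  attain a minimum; there \<open>Z\<close> is onto, hence injective by finite dimension. This is
  half of Fitting's lemma.\<close>

lemma eventually_bijective:
  fixes Z :: "'a::real_vector \<Rightarrow> 'a"
  assumes fd: "finite_dim TYPE('a)" and Z: "linear Z" and M: "subspace M" "Z ` M \<subseteq> M"
  obtains n where "Z ` ((Z ^^ n) ` M) = (Z ^^ n) ` M" "inj_on Z ((Z ^^ n) ` M)"
    "subspace ((Z ^^ n) ` M)" "(Z ^^ n) ` M \<subseteq> M"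
proof -
  obtain B0 :: "'a set" where "finite_dimensional_vector_space ((*\<^sub>R) :: real \<Rightarrow> 'a \<Rightarrow> 'a) B0"
    using finite_dim_locale[OF fd] by blast
  then interpret fd: finite_dimensional_vector_space "(*\<^sub>R) :: real \<Rightarrow> 'a \<Rightarrow> 'a" B0 .
  note raw = dim_raw_def[symmetric] dependent_raw_def[symmetric] span_raw_def[symmetric]
    subspace_raw_def[symmetric]
  note lin = linear_funpow[OF Z]
  obtain n where n: "\<And>m. dim ((Z ^^ n) ` M) \<le> dim ((Z ^^ m) ` M)"
    using ex_has_least_nat[of "\<lambda>_. True" 0 "\<lambda>n. dim ((Z ^^ n) ` M)"] by auto
  define Y where "Y = (Z ^^ n) ` M"
  have subY: "subspace Y"
    unfolding Y_def by (rule linear_subspace_image[OF lin M(1)])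
  have ZY: "Z ` Y = (Z ^^ Suc n) ` M"
    by (auto simp: Y_def image_image)
  have "Z ` Y = (Z ^^ n) ` (Z ` M)"
    unfolding ZY by (simp add: image_image funpow_swap1)
  then have sub: "Z ` Y \<subseteq> Y"
    using M(2) by (auto simp: Y_def)
  have dim: "dim Y \<le> dim (Z ` Y)"
    using n[of "Suc n"] ZY by (simp add: Y_def)
  have eq: "Z ` Y = Y"
    using fd.subspace_dim_equal[of "Z ` Y" Y] subY linear_subspace_image[OF Z subY] sub dim
    by (simp add: raw)
  obtain B where B: "independent B" "span B = Y" "finite B"
    using obtain_basis[OF fd subY] by blast
  have sp: "span (Z ` B) = Y"
    using B eq by (simp add: linear_span_image[OF Z])
  have cB: "card B = dim Y"
    using B basis_card_eq_dim[of B Y] span_superset[of B] by simp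
  have "dim Y \<le> card (Z ` B)"
    using sp B(3) span_card_ge_dim[of "Z ` B" Y] span_superset[of "Z ` B"] by simp
  then have inj: "inj_on Z B"
    using cB B(3) by (metis card_image_le eq_card_imp_inj_on le_antisym)
  then have "card (Z ` B) \<le> dim Y"
    using cB by (simp add: card_image)
  then have "independent (Z ` B)"
    using fd.card_le_dim_spanning[of "Z ` B" Y] sp B(3) span_superset[of "Z ` B"] by (simp add: raw)
  then have "inj_on Z Y"
    using linear_inj_on_span_independent_image[OF Z] inj B(2) by blast
  moreover have "Y \<subseteq> M"
  proof -
    have "(Z ^^ k) ` M \<subseteq> M" for k
      using M(2) by (induction k) auto
    then show ?thesis by (simp add: Y_def)
  qed
  ultimately show thesis
    using that[of n] eq subY by (simp add: Y_def)
qed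

text \<open>
  Jacobson's lemma.  On the stable image of \<open>Z\<close>, where \<open>Z\<close> has an inverse \<open>R\<close>, the identity
  equals \<open>R (X A - A X)\<close>; its trace is 0 because \<open>R\<close> commutes with \<open>A\<close>.
\<close>

lemma commutator_nilpotent:
  fixes X A Z :: "'a::real_vector \<Rightarrow> 'a"
  assumes fd: "finite_dim TYPE('a)" and lin: "linear X" "linear A" "linear Z"
    and M: "subspace M" "X ` M \<subseteq> M" "A ` M \<subseteq> M"
    and XA: "\<And>v. v \<in> M \<Longrightarrow> X (A v) - A (X v) = Z v"
    and AZ: "\<And>v. v \<in> M \<Longrightarrow> A (Z v) = Z (A v)"
    and XZ: "\<And>v. v \<in> M \<Longrightarrow> Z (X (Z v) - Z (X v)) = X (Z (Z v)) - Z (X (Z v))"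
  shows "\<exists>n. \<forall>v\<in>M. (Z ^^ n) v = 0"
proof -
  have ZM: "Z ` M \<subseteq> M"
  proof safe
    fix v assume "v \<in> M"
    then have "X (A v) - A (X v) \<in> M"
      using M by (auto intro!: subspace_diff)
    then show "Z v \<in> M" using XA \<open>v \<in> M\<close> by simp
  qed
  obtain n where eq: "Z ` ((Z ^^ n) ` M) = (Z ^^ n) ` M" and inj: "inj_on Z ((Z ^^ n) ` M)"
    and subY: "subspace ((Z ^^ n) ` M)" and YM: "(Z ^^ n) ` M \<subseteq> M"
    using eventually_bijective[OF fd lin(3) M(1) ZM] by blast
  define Y where "Y = (Z ^^ n) ` M"
  have powM: "(Z ^^ k) v \<in> M" if "v \<in> M" for k v
    using that ZM by (induction k) auto
  note linp = linear_funpow[OF lin(3)]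
  have Apow: "A ((Z ^^ k) v) = (Z ^^ k) (A v)" if "v \<in> M" for k v
    using that by (induction k) (auto simp: AZ powM)
  have AY: "A ` Y \<subseteq> Y"
    using M(3) Apow by (force simp: Y_def)
  \<comment> \<open>With D = [X, Z], the hypothesis \<open>XZ\<close> says that D commutes with Z.
    Then X acts as a derivation on powers: [X, Z^(k+1)] = (k+1) Z^k D.\<close>
  have Xpow: "X ((Z ^^ Suc k) v) = (Z ^^ Suc k) (X v) + real (Suc k) *\<^sub>R (Z ^^ k) (X (Z v) - Z (X v))"
    if "v \<in> M" for k v
    using that
  proof (induction k arbitrary: v)
    case 0
    then show ?case by simp
  next
    case (Suc k)
    define D where "D u = X (Z u) - Z (X u)" for u
    have Zv: "Z v \<in> M" using Suc.prems ZM by auto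
    have DZ: "D (Z v) = Z (D v)"
      using XZ[OF Suc.prems] by (simp add: D_def)
    have "X ((Z ^^ Suc (Suc k)) v) = X ((Z ^^ Suc k) (Z v))"
      by (simp add: funpow_swap1)
    also have "\<dots> = (Z ^^ Suc k) (X (Z v)) + real (Suc k) *\<^sub>R (Z ^^ k) (D (Z v))"
      using Suc.IH[OF Zv] by (simp add: D_def)
    also have "X (Z v) = Z (X v) + D v" by (simp add: D_def)
    also have "(Z ^^ Suc k) (Z (X v) + D v) + real (Suc k) *\<^sub>R (Z ^^ k) (D (Z v))
       = (Z ^^ Suc k) (Z (X v)) + (Z ^^ Suc k) (D v) + real (Suc k) *\<^sub>R (Z ^^ Suc k) (D v)"
      unfolding DZ by (simp add: linear_add[OF linp] linear_add[OF lin(3)] funpow_swap1)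
    also have "\<dots> = (Z ^^ Suc (Suc k)) (X v) + real (Suc (Suc k)) *\<^sub>R (Z ^^ Suc k) (D v)"
      by (simp add: funpow_swap1 algebra_simps scaleR_2)
    finally show ?case by (simp only: D_def)
  qed
  have XY: "X ` Y \<subseteq> Y"
  proof safe
    fix y assume "y \<in> Y"
    then have "y \<in> Z ` Y" using eq by (simp add: Y_def)
    \<comment> \<open>One spare power of \<open>Z\<close>, available because \<open>Z\<close> maps
      \<open>Y\<close> onto itself: the correction term in \<open>Xpow\<close> has one power less
      and must still lie in \<open>Y\<close>.\<close>
    then obtain m where m: "m \<in> M" "y = (Z ^^ Suc n) m" by (auto simp: Y_def)
    have "X (Z m) - Z (X m) \<in> M"
      using M ZM m(1) by (intro subspace_diff) (auto simp: image_subset_iff)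
    then have *: "(Z ^^ n) (X (Z m) - Z (X m)) \<in> Y" by (simp add: Y_def)
    have "(Z ^^ Suc n) (X m) = (Z ^^ n) (Z (X m))" by (simp add: funpow_swap1)
    moreover have "Z (X m) \<in> M" using M ZM m(1) by auto
    ultimately have "(Z ^^ Suc n) (X m) \<in> Y" by (simp add: Y_def)
    then show "X y \<in> Y"
      unfolding m(2) Xpow[OF m(1)] using * subY
      by (intro subspace_add subspace_scale) (auto simp: Y_def)
  qed
  obtain B where B: "independent B" "span B = Y" "finite B"
    using obtain_basis[OF fd subY] by (auto simp: Y_def)
  obtain R where R: "range R \<subseteq> Y" "linear R" "\<And>x. x \<in> Y \<Longrightarrow> R (Z x) = x"
    using linear_inj_on_left_inverse[OF lin(3), of B] inj unfolding B(2) Y_def[symmetric] by metis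
  have RA: "R (A y) = A (R y)" if "y \<in> Y" for y
  proof -
    obtain x where x: "x \<in> Y" "y = Z x" using \<open>y \<in> Y\<close> eq by (auto simp: Y_def)
    then have "A y = Z (A x)" using AZ YM by (auto simp: Y_def)
    then show ?thesis using R(3) x AY by auto
  qed
  have RY: "R ` Y \<subseteq> Y" using R(1) by auto
  have BY: "b \<in> Y" if "b \<in> B" for b using that B(2) span_base by blast
  \<comment> \<open>\<open>R\<close> inverts \<open>Z\<close> on \<open>Y\<close>, so this trace is
    the dimension of \<open>Y\<close>. Evaluating it a second time as 0 forces
    \<open>Y = {0}\<close>.\<close>
  have tr1: "trace_on B (\<lambda>v. R (Z v)) = real (card B)"
    using B by (simp add: trace_on_def R(3) BY representation_basis)
  have "trace_on B (\<lambda>v. R (Z v))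
    = trace_on B (\<lambda>v. R (X (A v))) - trace_on B (\<lambda>v. R (A (X v)))"
    unfolding trace_on_def sum_subtractf[symmetric]
  proof (intro sum.cong refl)
    fix b assume b: "b \<in> B"
    have "R (Z b) = R (X (A b)) - R (A (X b))"
      using XA[of b] BY[OF b] YM by (metis Y_def linear_diff[OF R(2)] subsetD)
    moreover have "R (X (A b)) \<in> span B" "R (A (X b)) \<in> span B"
      using R(1) B(2) by auto
    ultimately show "representation B (R (Z b)) b
       = representation B (R (X (A b))) b - representation B (R (A (X b))) b"
      by (simp add: representation_diff B(1))
  qed
  also have "trace_on B (\<lambda>v. R (A (X v))) = trace_on B (\<lambda>v. A (R (X v)))"
    unfolding trace_on_def using RA XY BY by (intro sum.cong refl) (simp add: image_subset_iff)
  also have "trace_on B (\<lambda>v. A (R (X v))) = trace_on B (\<lambda>v. R (X (A v)))"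
    using trace_on_comp_commute[OF B(1,3) lin(2) linear_compose[OF lin(1) R(2), unfolded o_def]]
      AY RY XY B(2) by (auto simp: image_subset_iff)
  finally have "B = {}" using tr1 B(3) by simp
  then have "Y = {0}" using B(2) by simp
  then show ?thesis by (auto simp: Y_def)
qed

text \<open>Induction over the operators: a vector killed by \<open>F\<close> is moved by the new
  operator as long as it stays nonzero. Commutation keeps it in the kernel of \<open>F\<close>, and
  nilpotency makes the process stop.\<close>

lemma common_kernel:
  fixes \<rho> :: "'b \<Rightarrow> 'a::real_vector \<Rightarrow> 'a"
  assumes "finite F" and lin: "\<And>z. z \<in> F \<Longrightarrow> linear (\<rho> z)"
    and inv: "\<And>z v. z \<in> F \<Longrightarrow> v \<in> M \<Longrightarrow> \<rho> z v \<in> M"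
    and comm: "\<And>z z' v. z \<in> F \<Longrightarrow> z' \<in> F \<Longrightarrow> v \<in> M \<Longrightarrow> \<rho> z (\<rho> z' v) = \<rho> z' (\<rho> z v)"
    and nil: "\<And>z. z \<in> F \<Longrightarrow> \<exists>n. \<forall>v\<in>M. (\<rho> z ^^ n) v = 0"
    and M: "m \<in> M" "m \<noteq> 0"
  shows "\<exists>v\<in>M. v \<noteq> 0 \<and> (\<forall>z\<in>F. \<rho> z v = 0)"
  using assms(1-5)
proof (induction F rule: finite_induct)
  case empty
  then show ?case using M by auto
next
  case (insert z F)
  have "\<exists>v\<in>M. v \<noteq> 0 \<and> (\<forall>z\<in>F. \<rho> z v = 0)"
    by (rule insert.IH) (simp_all add: insert.prems)
  then obtain v where v: "v \<in> M" "v \<noteq> 0" "\<forall>z\<in>F. \<rho> z v = 0"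
    by blast
  have pow: "(\<rho> z ^^ k) v \<in> M \<and> (\<forall>z'\<in>F. \<rho> z' ((\<rho> z ^^ k) v) = 0)" for k
  proof (induction k)
    case 0
    then show ?case using v by simp
  next
    case (Suc k)
    have "\<rho> z' (\<rho> z ((\<rho> z ^^ k) v)) = 0" if "z' \<in> F" for z'
      using insert.prems(3)[of z' z "(\<rho> z ^^ k) v"] Suc that linear_0[OF insert.prems(1)[of z]] by simp
    then show ?case
      using insert.prems(2) Suc by simp
  qed
  obtain n where n: "(\<rho> z ^^ n) v = 0" using insert.prems(4)[of z] v(1) by auto
  \<comment> \<open>At the first vanishing power; the vector one power earlier is the nonzero one
    that \<open>\<rho> z\<close> kills.\<close>
  define k where "k = (LEAST n. (\<rho> z ^^ n) v = 0)"
  have k: "(\<rho> z ^^ k) v = 0" unfolding k_def by (rule LeastI[of "\<lambda>n. (\<rho> z ^^ n) v = 0", OF n])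
  then have "k \<noteq> 0" using v(2) by (cases k) auto
  then obtain l where l: "k = Suc l" using not0_implies_Suc by blast
  then have "(\<rho> z ^^ l) v \<noteq> 0" using not_less_Least[of l "\<lambda>n. (\<rho> z ^^ n) v = 0"] by (auto simp: k_def)
  then show ?case using pow[of l] k l by (intro bexI[of _ "(\<rho> z ^^ l) v"]) auto
qed

section \<open>Representations of solvable Lie algebras\<close>

context real_lie_algebra
begin

lemmas br_simps = bilinear_ladd[OF bilinear] bilinear_radd[OF bilinear] bilinear_lmul[OF bilinear]
  bilinear_rmul[OF bilinear] bilinear_lneg[OF bilinear] bilinear_rneg[OF bilinear]
  bilinear_lzero[OF bilinear] bilinear_rzero[OF bilinear] bilinear_lsub[OF bilinear]
  bilinear_rsub[OF bilinear]

lemma linear_br: "linear (br x)"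
  using bilinear by (simp add: bilinear_def)

lemma linear_br_left: "linear (\<lambda>x. br x y)"
  using bilinear by (simp add: bilinear_def)

lemma br_skew: "br x y = - br y x"
proof -
  have "br (x + y) (x + y) = br x y + br y x"
    by (simp only: bilinear_ladd[OF bilinear] bilinear_radd[OF bilinear]) (simp add: alternating)
  then show ?thesis
    by (simp add: alternating eq_neg_iff_add_eq_0)
qed

lemma br_br: "br x (br y z) = br (br x y) z + br y (br x z)"
  using jacobi[of x y z] br_skew[of z x] br_skew[of z "br x y"]
  by (simp add: br_simps add_eq_0_iff algebra_simps)

lemma subspace_derived_series: "subspace (derived_series br n)"
  by (cases n) simp_all

lemma derived_series_ideal: "z \<in> derived_series br n \<Longrightarrow> br x z \<in> derived_series br n"
proof (induction n arbitrary: x z)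
  case 0
  then show ?case by simp
next
  case (Suc n)
  let ?G = "{br x y | x y. x \<in> derived_series br n \<and> y \<in> derived_series br n}"
  have "z \<in> span ?G" using Suc.prems by simp
  then have "br x z \<in> span ?G"
  proof (induction rule: span_induct)
    case base
    show ?case
      by (auto simp: subspace_def br_simps intro: span_add span_scale span_zero)
  next
    case (step z)
    then obtain a b where "z = br a b" "a \<in> derived_series br n" "b \<in> derived_series br n"
      by blast
    then have "br (br x a) b \<in> ?G" "br a (br x b) \<in> ?G"
      using Suc.IH by blast+
    then show ?case
      unfolding \<open>z = br a b\<close> br_br[of x a b] by (intro span_add span_base)
  qed
  then show ?case by simp
qed

lemma br_derived_series:
  "x \<in> derived_series br n \<Longrightarrow> y \<in> derived_series br n \<Longrightarrow> br x y \<in> derived_series br (Suc n)"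
  by (auto intro!: span_base)

lemma derived_series_Suc_subset: "derived_series br (Suc n) \<subseteq> derived_series br n"
  unfolding derived_series.simps
  by (rule span_minimal[OF _ subspace_derived_series]) (use derived_series_ideal in blast)

end

text \<open>The module is a subspace \<open>M\<close> of a type, and the representation identity is
  required only there. Joint kernels and orthogonal complements can thus serve as modules with
  operators defined on the whole type.\<close>

locale lie_rep = real_lie_algebra br for br :: "'b::real_vector \<Rightarrow> 'b \<Rightarrow> 'b" +
  fixes \<rho> :: "'b \<Rightarrow> 'a::real_vector \<Rightarrow> 'a" and M :: "'a set"
  assumes fd: "finite_dim TYPE('a)"
    and bilinear_rep: "bilinear \<rho>"
    and M: "subspace M" "M \<noteq> {0}"
    and inv: "v \<in> M \<Longrightarrow> \<rho> x v \<in> M"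
    and rep: "v \<in> M \<Longrightarrow> \<rho> (br x y) v = \<rho> x (\<rho> y v) - \<rho> y (\<rho> x v)"
begin

lemma rep_lin: "linear (\<rho> x)"
  using bilinear_rep by (simp add: bilinear_def)

lemma rep_lin_left: "linear (\<lambda>x. \<rho> x v)"
  using bilinear_rep by (simp add: bilinear_def)

lemma rep_commute:
  assumes "v \<in> M" "\<rho> (br x y) v = 0"
  shows "\<rho> x (\<rho> y v) = \<rho> y (\<rho> x v)"
  using rep[OF assms(1), of x y] assms(2) by simp

text \<open>
  Every operator \<open>\<rho> z\<close>, \<open>z \<in> G\<close>, is a commutator \<open>[\<rho> x, \<rho> a]\<close> commuting with \<open>\<rho> a\<close>, so
  Jacobson's lemma makes it nilpotent.
\<close>

lemma kernel_of_commutators: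
  assumes G: "\<And>z. z \<in> G \<Longrightarrow> \<exists>x a. z = br x a \<and>
      (\<forall>v\<in>M. \<rho> (br a z) v = 0) \<and> (\<forall>v\<in>M. \<rho> (br (br x z) z) v = 0)"
    and comm: "\<And>z z' v. z \<in> G \<Longrightarrow> z' \<in> G \<Longrightarrow> v \<in> M \<Longrightarrow> \<rho> (br z z') v = 0"
  shows "\<exists>v\<in>M. v \<noteq> 0 \<and> (\<forall>z\<in>span G. \<rho> z v = 0)"
proof -
  obtain F where F: "F \<subseteq> G" "independent F" "G \<subseteq> span F"
    using maximal_independent_subset[of G] by blast
  have fin: "finite F" by (rule finite_basis[OF finite_dim F(2)])
  obtain m where m: "m \<in> M" "m \<noteq> 0"
    using M subspace_0 by blast
  have nil: "\<exists>n. \<forall>v\<in>M. (\<rho> z ^^ n) v = 0" if zF: "z \<in> F" for z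
  proof -
    obtain x a where z: "z = br x a" and a: "\<And>v. v \<in> M \<Longrightarrow> \<rho> (br a z) v = 0"
      and x: "\<And>v. v \<in> M \<Longrightarrow> \<rho> (br (br x z) z) v = 0"
      using G[OF subsetD[OF F(1) zF]] by blast
    show ?thesis
    proof (rule commutator_nilpotent[OF fd rep_lin[of x] rep_lin[of a] rep_lin M(1)])
      fix v assume v: "v \<in> M"
      show "\<rho> x (\<rho> a v) - \<rho> a (\<rho> x v) = \<rho> z v" using rep[OF v] z by simp
      show "\<rho> a (\<rho> z v) = \<rho> z (\<rho> a v)" by (rule rep_commute[OF v a[OF v]])
      show "\<rho> z (\<rho> x (\<rho> z v) - \<rho> z (\<rho> x v)) = \<rho> x (\<rho> z (\<rho> z v)) - \<rho> z (\<rho> x (\<rho> z v))"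
        using rep_commute[OF v x[OF v]] rep[OF v, of x z] rep[OF inv[OF v], of x z z] by simp
    qed (use inv in auto)
  qed
  have "\<exists>v\<in>M. v \<noteq> 0 \<and> (\<forall>z\<in>F. \<rho> z v = 0)"
  proof (rule common_kernel[OF fin rep_lin _ _ nil m])
    fix z z' v assume "z \<in> F" "z' \<in> F" "v \<in> M"
    then show "\<rho> z (\<rho> z' v) = \<rho> z' (\<rho> z v)"
      using comm F(1) by (intro rep_commute) auto
  qed (use inv in auto)
  then obtain v where v: "v \<in> M" "v \<noteq> 0" "\<And>z. z \<in> F \<Longrightarrow> \<rho> z v = 0"
    by blast
  have "\<rho> z v = 0" if "z \<in> span G" for z
  proof -
    have "z \<in> span F" using that F(3) span_minimal[of G "span F"] by auto
    then show ?thesis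
      using linear_eq_0_on_span[OF rep_lin_left, of F v] v(3) by blast
  qed
  with v show ?thesis by blast
qed

text \<open>If \<open>\<rho> z\<close> and \<open>\<rho> (br x z)\<close> both kill
  \<open>v\<close>, then \<open>\<rho> z\<close> kills \<open>\<rho> x v\<close>. So the joint
  kernel of a set closed under all \<open>br x\<close> is again a module.\<close>

lemma sub_rep:
  assumes ideal: "\<And>x z. z \<in> G \<Longrightarrow> br x z \<in> G"
    and ne: "v \<in> M" "v \<noteq> 0" "\<And>z. z \<in> G \<Longrightarrow> \<rho> z v = 0"
  shows "lie_rep br \<rho> {v\<in>M. \<forall>z\<in>G. \<rho> z v = 0}"
proof unfold_locales
  let ?N = "{v\<in>M. \<forall>z\<in>G. \<rho> z v = 0}"
  show "finite_dim TYPE('a)" "bilinear \<rho>" by (fact fd bilinear_rep)+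
  show "subspace ?N"
    using M(1) by (auto simp: subspace_def linear_0[OF rep_lin] linear_add[OF rep_lin]
        linear_scale[OF rep_lin])
  show "?N \<noteq> {0}" using ne by blast
  show "\<rho> (br x y) v = \<rho> x (\<rho> y v) - \<rho> y (\<rho> x v)" if "v \<in> ?N" for v x y
    using that rep by simp
  show "\<rho> x v \<in> ?N" if "v \<in> ?N" for v x
  proof -
    have "\<rho> z (\<rho> x v) = 0" if "z \<in> G" for z
      using rep_commute[of v x z] ideal[OF \<open>z \<in> G\<close>] that \<open>v \<in> ?N\<close> linear_0[OF rep_lin] by simp
    then show ?thesis using that inv by simp
  qed
qed

text \<open>Two stages are needed. For z = [x, a] with x, a in the j-th term, [a, z] need not lie in
  the term of index j+2, so Jacobson's lemma does not apply at once. It does apply to the brackets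
  [x, a] with a in the term of index j+1 and x arbitrary. On their joint kernel \<open>?M2\<close>
  every bracket with an element of that term acts by 0, and the lemma then applies to the generators
  \<open>?H\<close> of the term itself.\<close>

lemma derived_kernel_step:
  assumes "v \<in> M" "v \<noteq> 0" "\<forall>z\<in>derived_series br (Suc (Suc j)). \<rho> z v = 0"
  shows "\<exists>v\<in>M. v \<noteq> 0 \<and> (\<forall>z\<in>derived_series br (Suc j). \<rho> z v = 0)"
proof -
  let ?D = "derived_series br"
  let ?M1 = "{v\<in>M. \<forall>z\<in>?D (Suc (Suc j)). \<rho> z v = 0}"
  interpret M1: lie_rep br \<rho> ?M1
    using derived_series_ideal assms by (intro sub_rep) (blast+)
  let ?G = "{br x a | x a. a \<in> ?D (Suc j)}"
  have GD: "z \<in> ?D (Suc j)" if "z \<in> ?G" for z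
    using that derived_series_ideal by blast
  have DD: "\<rho> (br a z) v = 0" if "a \<in> ?D (Suc j)" "z \<in> ?D (Suc j)" "v \<in> ?M1" for a z v
    using br_derived_series that by blast
  have "\<exists>v\<in>?M1. v \<noteq> 0 \<and> (\<forall>z\<in>span ?G. \<rho> z v = 0)"
  proof (rule M1.kernel_of_commutators)
    show "\<rho> (br z z') v = 0" if "z \<in> ?G" "z' \<in> ?G" "v \<in> ?M1" for z z' v
      by (rule DD[OF GD[OF that(1)] GD[OF that(2)] that(3)])
    show "\<exists>x a. z = br x a \<and> (\<forall>v\<in>?M1. \<rho> (br a z) v = 0) \<and>
        (\<forall>v\<in>?M1. \<rho> (br (br x z) z) v = 0)" if z: "z \<in> ?G" for z
    proof -
      obtain x a where xa: "z = br x a" "a \<in> ?D (Suc j)" using z by blast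
      show ?thesis
        by (intro exI[of _ x] exI[of _ a] conjI ballI xa(1) DD[OF xa(2) GD[OF z]]
            DD[OF derived_series_ideal[OF GD[OF z]] GD[OF z]])
    qed
  qed
  then obtain u where u: "u \<in> ?M1" "u \<noteq> 0" "\<And>z. z \<in> span ?G \<Longrightarrow> \<rho> z u = 0"
    by blast
  let ?M2 = "{v\<in>?M1. \<forall>z\<in>?G. \<rho> z v = 0}"
  have "br x z \<in> ?G" if "z \<in> ?G" for x z
    using GD[OF that] by blast
  then have "lie_rep br \<rho> ?M2"
    by (rule M1.sub_rep[OF _ u(1,2) u(3)[OF span_base]])
  then interpret M2: lie_rep br \<rho> ?M2 .
  let ?H = "{br x y | x y. x \<in> ?D j \<and> y \<in> ?D j}"
  have HD: "z \<in> ?D (Suc j)" if "z \<in> ?H" for z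
    using that by (auto intro: span_base)
  have D0: "\<rho> (br x z) v = 0" if "z \<in> ?D (Suc j)" "v \<in> ?M2" for x z v
    using that by blast
  have "\<exists>v\<in>?M2. v \<noteq> 0 \<and> (\<forall>z\<in>span ?H. \<rho> z v = 0)"
  proof (rule M2.kernel_of_commutators)
    show "\<rho> (br z z') v = 0" if "z \<in> ?H" "z' \<in> ?H" "v \<in> ?M2" for z z' v
      by (rule D0[OF HD[OF that(2)] that(3)])
    show "\<exists>x a. z = br x a \<and> (\<forall>v\<in>?M2. \<rho> (br a z) v = 0) \<and>
        (\<forall>v\<in>?M2. \<rho> (br (br x z) z) v = 0)" if z: "z \<in> ?H" for z
    proof -
      obtain x a where "z = br x a" using z by blast
      then show ?thesis using D0[OF HD[OF z]] by blast
    qed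
  qed
  then show ?thesis by auto
qed

text \<open>The part of Lie's theorem that needs no eigenvalues.\<close>

lemma solvable_common_kernel:
  assumes "solvable br"
  shows "\<exists>v\<in>M. v \<noteq> 0 \<and> (\<forall>z\<in>derived_series br 1. \<rho> z v = 0)"
proof -
  obtain m where m: "derived_series br m = {0}"
    using assms by (auto simp: solvable_def)
  \<comment> \<open>The descent is stated for successor indices and ends at 1, whereas
    \<open>m\<close> may be 0; hence the start one index later.\<close>
  have "derived_series br (Suc m) = {0}"
    using derived_series_Suc_subset[of m] m subspace_0[OF subspace_derived_series[of "Suc m"]]
    by (metis singletonD subset_singletonD empty_iff)
  moreover obtain u where "u \<in> M" "u \<noteq> 0"
    using M subspace_0 by blast
  ultimately have *: "\<exists>v\<in>M. v \<noteq> 0 \<and> (\<forall>z\<in>derived_series br (Suc m). \<rho> z v = 0)"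
    using linear_0[OF rep_lin_left] by (metis singletonD)
  have "\<exists>v\<in>M. v \<noteq> 0 \<and> (\<forall>z\<in>derived_series br (Suc 0). \<rho> z v = 0)"
    using le0[of m]
  proof (induction rule: inc_induct)
    case base
    show ?case by (rule *)
  next
    case (step n)
    then obtain v where "v \<in> M" "v \<noteq> 0" "\<forall>z\<in>derived_series br (Suc (Suc n)). \<rho> z v = 0"
      by blast
    then show ?case by (rule derived_kernel_step)
  qed
  then show ?thesis by simp
qed

end

section \<open>Orthonormal bases and the Killing form\<close>

locale fin_inner =
  fixes ip :: "'a::real_vector \<Rightarrow> 'a \<Rightarrow> real"
  assumes fd: "finite_dim TYPE('a)" and ip: "inner_product ip"
begin

lemma bilinear_ip: "bilinear ip"
  using ip by (simp add: inner_product_def)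

lemma ip_sym: "ip x y = ip y x"
  using ip by (simp add: inner_product_def)

lemma ip_pos: "x \<noteq> 0 \<Longrightarrow> ip x x > 0"
  using ip by (simp add: inner_product_def)

lemmas ip_simps = bilinear_ladd[OF bilinear_ip] bilinear_radd[OF bilinear_ip]
  bilinear_lmul[OF bilinear_ip] bilinear_rmul[OF bilinear_ip] bilinear_lneg[OF bilinear_ip]
  bilinear_rneg[OF bilinear_ip] bilinear_lzero[OF bilinear_ip] bilinear_rzero[OF bilinear_ip]
  bilinear_lsub[OF bilinear_ip] bilinear_rsub[OF bilinear_ip]

lemma ip_eq_0_iff [simp]: "ip x x = 0 \<longleftrightarrow> x = 0"
  using ip_pos[of x] by (cases "x = 0") (auto simp: ip_simps)

lemma ip_nonneg: "ip x x \<ge> 0"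
  using ip_pos[of x] by (cases "x = 0") (auto simp: ip_simps)

lemma ip_ext: "(\<And>z. ip x z = ip y z) \<Longrightarrow> x = y"
  using ip_eq_0_iff[of "x - y"] by (simp add: ip_simps)

lemma linear_ip_left: "linear (\<lambda>x. ip x y)"
  using bilinear_ip by (simp add: bilinear_def)

lemma linear_ip: "linear (ip x)"
  using bilinear_ip by (simp add: bilinear_def)

definition orthonormal :: "'a set \<Rightarrow> bool" where
  "orthonormal E \<longleftrightarrow> finite E \<and> (\<forall>u\<in>E. \<forall>v\<in>E. ip u v = (if u = v then 1 else 0))"

definition onb :: "'a set \<Rightarrow> bool" where
  "onb E \<longleftrightarrow> orthonormal E \<and> span E = UNIV"

definition proj :: "'a set \<Rightarrow> 'a \<Rightarrow> 'a" where
  "proj E x = (\<Sum>e\<in>E. ip x e *\<^sub>R e)"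

lemma linear_proj: "linear (proj E)"
  by (rule linearI) (simp_all add: proj_def ip_simps scaleR_add_left sum.distrib scaleR_sum_right)

lemma proj_in_span: "proj E x \<in> span E"
  unfolding proj_def by (intro span_sum span_scale span_base)

lemma ip_sum_basis:
  assumes "orthonormal E" "u \<in> E"
  shows "ip (\<Sum>e\<in>E. c e *\<^sub>R e) u = c u"
proof -
  have "ip (\<Sum>e\<in>E. c e *\<^sub>R e) u = (\<Sum>e\<in>E. c e * ip e u)"
    by (simp add: linear_sum[OF linear_ip_left] ip_simps)
  also have "\<dots> = (\<Sum>e\<in>E. if e = u then c e else 0)"
    using assms by (intro sum.cong) (auto simp: orthonormal_def)
  also have "\<dots> = c u"
    using assms by (simp add: orthonormal_def)
  finally show ?thesis .
qed

lemma proj_span: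
  assumes E: "orthonormal E" and x: "x \<in> span E"
  shows "proj E x = x"
proof (rule linear_eq_on_span[OF linear_proj linear_ident _ x])
  fix u assume u: "u \<in> E"
  have "proj E u = (\<Sum>e\<in>E. if e = u then e else 0)"
    unfolding proj_def using E u by (intro sum.cong) (auto simp: orthonormal_def)
  also have "\<dots> = u"
    using E u by (simp add: orthonormal_def)
  finally show "proj E u = u" .
qed

lemma proj_orth:
  assumes E: "orthonormal E" and y: "y \<in> span E"
  shows "ip (x - proj E x) y = 0"
proof -
  have "ip (x - proj E x) e = 0" if "e \<in> E" for e
    using ip_sum_basis[OF E that, of "\<lambda>e. ip x e"] by (simp add: ip_simps proj_def)
  then show ?thesis
    using linear_eq_0_on_span[OF linear_ip, of E "x - proj E x" y] y by simp
qed

lemma orthonormal_independent: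
  assumes "orthonormal E"
  shows "independent E"
proof -
  have fin: "finite E" using assms by (simp add: orthonormal_def)
  show ?thesis
    unfolding dependent_finite[OF fin] using ip_sum_basis[OF assms] by (metis ip_simps(7))
qed

lemma onb_expand: "onb E \<Longrightarrow> (\<Sum>e\<in>E. ip x e *\<^sub>R e) = x"
  using proj_span[of E x] by (simp add: onb_def proj_def)

lemma parseval:
  assumes "onb E"
  shows "(\<Sum>e\<in>E. ip x e * ip y e) = ip x y"
proof -
  have "ip x y = ip (\<Sum>e\<in>E. ip x e *\<^sub>R e) y"
    by (simp add: onb_expand[OF assms])
  also have "\<dots> = (\<Sum>e\<in>E. ip x e * ip y e)"
    by (simp add: linear_sum[OF linear_ip_left] ip_simps ip_sym[of y])
  finally show ?thesis by simp
qed

lemma orthonormal_insert: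
  assumes E: "orthonormal E" and x: "x \<notin> span E"
  obtains u where "orthonormal (insert u E)" "u \<notin> E" "span (insert u E) = span (insert x E)"
proof -
  define w where "w = x - proj E x"
  define u where "u = (1 / sqrt (ip w w)) *\<^sub>R w"
  have "w \<noteq> 0" using x proj_in_span[of E x] by (auto simp: w_def)
  then have pos: "ip w w > 0" by (rule ip_pos)
  have orth: "ip u e = 0" "ip e u = 0" if "e \<in> E" for e
    using proj_orth[OF E span_base[OF that], of x] ip_sym[of e u]
    by (simp_all add: u_def w_def ip_simps)
  have norm: "ip u u = 1"
    using pos \<open>w \<noteq> 0\<close> by (simp add: u_def ip_simps field_simps)
  have "u \<notin> E" using orth norm by force
  moreover have "orthonormal (insert u E)"
    using E orth norm by (auto simp: orthonormal_def)
  moreover have "span (insert u E) = span (insert x E)"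
  proof -
    have w': "w = sqrt (ip w w) *\<^sub>R u"
      using \<open>w \<noteq> 0\<close> by (simp add: u_def)
    have "proj E x \<in> span (insert x E)" "proj E x \<in> span (insert u E)"
      using proj_in_span span_mono[of E "insert _ E"] by blast+
    moreover have "w \<in> span (insert u E)"
      by (subst w') (intro span_scale span_base insertI1)
    ultimately have "w + proj E x \<in> span (insert u E)" "x - proj E x \<in> span (insert x E)"
      by (blast intro: span_add span_diff span_base)+
    then have "x \<in> span (insert u E)" "u \<in> span (insert x E)"
      unfolding w_def u_def by (auto intro: span_scale)
    moreover have "E \<subseteq> span (insert u E)" "E \<subseteq> span (insert x E)"
      by (auto intro: span_base)
    ultimately show ?thesis
      by (intro equalityI span_minimal) auto
  qed
  ultimately show thesis using that by blast
qed

lemma orthonormal_extend: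
  assumes E: "orthonormal E" and B: "finite B"
  obtains E' where "E \<subseteq> E'" "orthonormal E'" "span E' = span (E \<union> B)"
proof -
  have "\<exists>E'. E \<subseteq> E' \<and> orthonormal E' \<and> span E' = span (E \<union> B)"
    using B
  proof (induction B rule: finite_induct)
    case empty
    then show ?case using E by auto
  next
    case (insert b B)
    then obtain E' where E': "E \<subseteq> E'" "orthonormal E'" "span E' = span (E \<union> B)"
      by blast
    have sp: "span (insert b E') = span (E \<union> insert b B)"
      using E'(3) by (simp add: span_insert)
    show ?case
    proof (cases "b \<in> span E'")
      case True
      then show ?thesis using E' sp by (metis span_redundant)
    next
      case False
      then obtain u where "orthonormal (insert u E')" "span (insert u E') = span (insert b E')"
        using orthonormal_insert[OF E'(2)] by metis
      then show ?thesis using E' sp by (intro exI[of _ "insert u E'"]) auto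
    qed
  qed
  then show thesis using that by blast
qed

lemma orthonormal_extend_subspace:
  assumes E: "orthonormal E" and S: "subspace S" "E \<subseteq> S"
  obtains E' where "E \<subseteq> E'" "orthonormal E'" "span E' = S"
proof -
  obtain B where B: "span B = S" "finite B"
    using obtain_basis[OF fd S(1)] by blast
  obtain E' where "E \<subseteq> E'" "orthonormal E'" "span E' = span (E \<union> B)"
    using orthonormal_extend[OF E B(2)] by blast
  moreover have "span (E \<union> B) = S"
    using B S span_superset[of B] by (intro equalityI span_minimal) (auto simp: B(1)[symmetric] intro: span_mono[THEN subsetD])
  ultimately show thesis using that by simp
qed

lemma orthonormal_empty: "orthonormal {}"
  by (simp add: orthonormal_def)

lemma op_trace_onb:
  assumes f: "linear f" and E: "onb E"
  shows "op_trace f = (\<Sum>e\<in>E. ip (f e) e)"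
proof -
  have E': "orthonormal E" "span E = UNIV" "independent E" "finite E"
    using E orthonormal_independent by (auto simp: onb_def orthonormal_def)
  have "representation E v e = ip v e" if "e \<in> E" for v e
  proof -
    have "v = (\<Sum>e\<in>E. representation E v e *\<^sub>R e)"
      using sum_representation_eq[of E v E] E' by simp
    then show ?thesis using ip_sum_basis[OF E'(1) that] by metis
  qed
  then show ?thesis
    by (simp add: op_trace_eq[OF fd f E'(3,2)])
qed

text \<open>The trace of a bilinear form with respect to \<open>ip\<close> does not depend on the
  orthonormal basis. The coordinates of the vectors \<open>U e\<close> form an orthogonal matrix,
  which collapses the double sum to its diagonal. The main use is with \<open>J\<close> for
  \<open>U\<close>.\<close>

lemma sum_onb_isometry:
  fixes \<phi> :: "'a \<Rightarrow> 'a \<Rightarrow> real"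
  assumes \<phi>: "bilinear \<phi>" and E: "onb E" and U: "linear U" "\<And>x y. ip (U x) (U y) = ip x y"
    "\<And>x. U (V x) = x"
  shows "(\<Sum>e\<in>E. \<phi> (U e) (U e)) = (\<Sum>e\<in>E. \<phi> e e)"
proof -
  have fin: "finite E" using E by (simp add: onb_def orthonormal_def)
  have "(\<Sum>e\<in>E. \<phi> (U e) (U e))
     = (\<Sum>e\<in>E. \<Sum>f\<in>E. \<Sum>g\<in>E. ip (U e) f * ip (U e) g * \<phi> f g)"
  proof (rule sum.cong[OF refl])
    fix e
    have "\<phi> (U e) (U e) = \<phi> (\<Sum>f\<in>E. ip (U e) f *\<^sub>R f) (\<Sum>f\<in>E. ip (U e) f *\<^sub>R f)"
      by (simp add: onb_expand[OF E])
    also have "\<dots> = (\<Sum>f\<in>E. \<Sum>g\<in>E. ip (U e) f * ip (U e) g * \<phi> f g)"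
      unfolding bilinear_sum[OF \<phi>] sum.cartesian_product
      by (intro sum.cong) (auto simp: bilinear_lmul[OF \<phi>] bilinear_rmul[OF \<phi>])
    finally show "\<phi> (U e) (U e) = (\<Sum>f\<in>E. \<Sum>g\<in>E. ip (U e) f * ip (U e) g * \<phi> f g)" .
  qed
  also have "\<dots> = (\<Sum>f\<in>E. \<Sum>e\<in>E. \<Sum>g\<in>E. ip (U e) f * ip (U e) g * \<phi> f g)"
    by (rule sum.swap)
  also have "\<dots> = (\<Sum>f\<in>E. \<Sum>g\<in>E. \<Sum>e\<in>E. ip (U e) f * ip (U e) g * \<phi> f g)"
    by (intro sum.cong refl sum.swap)
  also have "\<dots> = (\<Sum>f\<in>E. \<Sum>g\<in>E. (\<Sum>e\<in>E. ip (U e) f * ip (U e) g) * \<phi> f g)"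
    by (simp add: sum_distrib_right)
  also have "\<dots> = (\<Sum>f\<in>E. \<Sum>g\<in>E. ip f g * \<phi> f g)"
  proof (intro sum.cong refl)
    fix f g
    \<comment> \<open>For an isometry the right inverse \<open>V\<close> is the adjoint; this lets
      Parseval be applied to the sum over \<open>e\<close>.\<close>
    have "ip (U e) f = ip (V f) e" for e f
      using U(2)[of e "V f"] U(3)[of f] ip_sym[of e "V f"] by simp
    then have "(\<Sum>e\<in>E. ip (U e) f * ip (U e) g) = ip (V f) (V g)"
      by (simp add: parseval[OF E])
    also have "\<dots> = ip f g"
      using U(2)[of "V f" "V g"] U(3) by simp
    finally show "(\<Sum>e\<in>E. ip (U e) f * ip (U e) g) * \<phi> f g = ip f g * \<phi> f g" by simp
  qed
  also have "\<dots> = (\<Sum>f\<in>E. \<phi> f f)"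
  proof (intro sum.cong refl)
    fix f assume f: "f \<in> E"
    have "(\<Sum>g\<in>E. ip f g * \<phi> f g) = (\<Sum>g\<in>E. if f = g then \<phi> f g else 0)"
      using f E by (intro sum.cong) (auto simp: onb_def orthonormal_def)
    then show "(\<Sum>g\<in>E. ip f g * \<phi> f g) = \<phi> f f"
      using f fin by simp
  qed
  finally show ?thesis .
qed

end

section \<open>Vanishing of the Killing form on the derived algebra\<close>

locale lie_inner = real_lie_algebra br for br :: "'a::real_vector \<Rightarrow> 'a \<Rightarrow> 'a" +
  fixes ip :: "'a \<Rightarrow> 'a \<Rightarrow> real"
  assumes inner: "inner_product ip"

sublocale lie_inner \<subseteq> fin_inner ip
  by unfold_locales (rule finite_dim inner)+

context lie_inner
begin

text \<open>The quotient by the ideal \<open>span W\<close> is modelled on its orthogonal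
  complement, with \<open>Q\<close> as the projection. A vector there killed by the derived algebra
  is what is asked for.\<close>

lemma larger_ideal:
  assumes solv: "solvable br" and W: "orthonormal W" "\<And>x w. w \<in> span W \<Longrightarrow> br x w \<in> span W"
    "span W \<noteq> UNIV"
  shows "\<exists>v. v \<notin> span W \<and> (\<forall>z\<in>derived_series br 1. br z v \<in> span W)"
proof -
  define Q where "Q x = x - proj W x" for x
  have linQ: "linear Q"
    unfolding Q_def by (intro linear_compose_sub linear_ident linear_proj)
  have Q0: "Q x = 0 \<longleftrightarrow> x \<in> span W" for x
    using proj_span[OF W(1), of x] proj_in_span[of W x] by (auto simp: Q_def)
  define M where "M = {v. \<forall>w\<in>span W. ip v w = 0}"
  have QM: "Q x \<in> M" for x
    using proj_orth[OF W(1)] by (simp add: M_def Q_def)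
  have Qdiff: "x - Q x \<in> span W" for x
    by (simp add: Q_def proj_in_span)
  have QM_id: "v \<in> span W \<Longrightarrow> v \<in> M \<Longrightarrow> v = 0" for v
    by (auto simp: M_def)
  interpret lie_rep br "\<lambda>x v. Q (br x v)" M
  proof unfold_locales
    show "finite_dim TYPE('a)" by (rule fd)
    show "bilinear (\<lambda>x v. Q (br x v))"
      unfolding bilinear_def
      using linear_compose[OF linear_br linQ] linear_compose[OF linear_br_left linQ]
      by (simp add: o_def)
    show "subspace M"
      by (auto simp: M_def subspace_def ip_simps)
    obtain x where x: "x \<notin> span W" using W(3) by auto
    then show "M \<noteq> {0}" using QM[of x] Q0[of x] by auto
    show "Q (br x v) \<in> M" for x v by (rule QM)
    show "Q (br (br x y) v) = Q (br x (Q (br y v))) - Q (br y (Q (br x v)))" for x y v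
    proof -
      have *: "Q (br x (Q u)) = Q (br x u)" for x u
      proof -
        have "br x (u - Q u) \<in> span W" by (intro W(2) Qdiff)
        then have "Q (br x u - br x (Q u)) = 0" by (simp add: Q0 br_simps)
        then show ?thesis by (simp add: linear_diff[OF linQ])
      qed
      show ?thesis
        using br_br[of x y v] by (simp add: * linear_diff[OF linQ, symmetric])
    qed
  qed
  obtain v where v: "v \<in> M" "v \<noteq> 0" "\<forall>z\<in>derived_series br 1. Q (br z v) = 0"
    using solvable_common_kernel[OF solv] by blast
  then show ?thesis using Q0 QM_id by blast
qed

text \<open>An orthonormal basis is built along a flag of ideals whose steps \<open>br z\<close>
  moves downwards, so that \<open>br x (br z e)\<close> is orthogonal to \<open>e\<close> for every
  basis vector. The induction enlarges \<open>W\<close> while keeping its span an ideal and the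
  partial trace \<open>t W\<close> zero.\<close>

lemma trace_derived_eq_0:
  assumes solv: "solvable br" and z: "z \<in> derived_series br 1"
  shows "op_trace (\<lambda>v. br x (br z v)) = 0"
proof -
  define t where "t W = (\<Sum>e\<in>W. ip (br x (br z e)) e)" for W
  obtain B :: "'a set" where B: "independent B" "span B = UNIV" "finite B"
    using obtain_basis[OF fd subspace_UNIV] by blast
  have "\<exists>E. onb E \<and> t E = 0"
    if "orthonormal W" "\<And>x w. w \<in> span W \<Longrightarrow> br x w \<in> span W" "t W = 0" for W
    using that
  proof (induction "card B - card W" arbitrary: W rule: less_induct)
    case less
    note W = less.prems
    show ?case
    proof (cases "span W = UNIV")
      case True
      then show ?thesis using W by (auto simp: onb_def)
    next
      case False
      obtain v where v: "v \<notin> span W" "\<forall>z\<in>derived_series br 1. br z v \<in> span W"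
        using larger_ideal[OF solv W(1,2) False] by blast
      \<comment> \<open>The preimage of all vectors of the quotient killed by the derived algebra.
        Taking all of them, and not only \<open>v\<close>, makes the enlarged space an ideal
        again.\<close>
      define U where "U = {u. \<forall>z\<in>derived_series br 1. br z u \<in> span W}"
      have U: "subspace U"
        by (auto simp: U_def subspace_def br_simps intro: span_zero span_add span_scale)
      have WU: "span W \<subseteq> U" using W(2) by (auto simp: U_def)
      have idU: "br y u \<in> U" if u: "u \<in> U" for y u
        unfolding U_def
      proof safe
        fix z assume z: "z \<in> derived_series br 1"
        have "br z (br y u) = br y (br z u) - br (br y z) u"
          using br_br[of y z u] by simp
        moreover have "br y (br z u) \<in> span W" "br (br y z) u \<in> span W"
          using u z W(2) derived_series_ideal[OF z, of y] by (auto simp: U_def)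
        ultimately show "br z (br y u) \<in> span W"
          by (simp add: span_diff)
      qed
      obtain W' where W': "W \<subseteq> W'" "orthonormal W'" "span W' = U"
        using orthonormal_extend_subspace[OF W(1) U] WU span_superset[of W] by blast
      have fin: "finite W'" using W'(2) by (simp add: orthonormal_def)
      have "v \<in> span W'" using v(2) W'(3) by (simp add: U_def)
      then have "W' \<noteq> W" using v(1) by auto
      then have "card W < card W'"
        using W'(1) fin by (intro psubset_card_mono) auto
      moreover have "card W' \<le> card B"
        using independent_span_bound[OF B(3) orthonormal_independent[OF W'(2)]] B(2) by simp
      ultimately have lt: "card B - card W' < card B - card W" by simp
      have "t W' = t W"
      proof -
        have "ip (br x (br z e)) e = 0" if e: "e \<in> W' - W" for e
        proof -
          have "ip e w = 0" if "w \<in> W" for w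
            using W' e that by (auto simp: orthonormal_def)
          then have "ip e w = 0" if "w \<in> span W" for w
            using linear_eq_0_on_span[OF linear_ip, of W e w] that by blast
          moreover have "e \<in> U" using e W'(3) span_base by blast
          then have "br x (br z e) \<in> span W" using z W(2) by (simp add: U_def)
          ultimately show ?thesis by (metis ip_sym)
        qed
        then show ?thesis
          unfolding t_def using W'(1) fin by (intro sum.mono_neutral_right) auto
      qed
      then show ?thesis
        using less.hyps[OF lt W'(2)] idU W'(3) W(3) by simp
    qed
  qed
  from this[OF orthonormal_empty] obtain E where "onb E" "t E = 0"
    by (auto simp: t_def br_simps)
  moreover have "linear (\<lambda>v. br x (br z v))"
    using linear_compose[OF linear_br[of z] linear_br[of x]] by (simp add: o_def)
  ultimately show ?thesis
    by (simp add: op_trace_onb t_def)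
qed

end

section \<open>Locally conformally Kaehler Lie algebras\<close>

context fin_inner
begin

lemma onb_exists: obtains E where "onb E"
  using orthonormal_extend_subspace[OF orthonormal_empty subspace_UNIV] by (auto simp: onb_def)

lemma sum_ip_comp_commute:
  assumes E: "onb E" and f: "linear f" and g: "linear g"
  shows "(\<Sum>e\<in>E. ip (f (g e)) e) = (\<Sum>e\<in>E. ip (g (f e)) e)"
proof -
  have *: "ip (f (g e)) e = (\<Sum>k\<in>E. ip (g e) k * ip (f k) e)" if "linear f" for f g e
  proof -
    have "f (g e) = f (\<Sum>k\<in>E. ip (g e) k *\<^sub>R k)" by (simp add: onb_expand[OF E])
    then show ?thesis
      by (simp add: linear_sum[OF that] linear_scale[OF that] linear_sum[OF linear_ip_left] ip_simps)
  qed
  have "(\<Sum>e\<in>E. ip (f (g e)) e) = (\<Sum>e\<in>E. \<Sum>k\<in>E. ip (g e) k * ip (f k) e)"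
    by (simp only: *[OF f])
  also have "\<dots> = (\<Sum>k\<in>E. \<Sum>e\<in>E. ip (f k) e * ip (g e) k)"
    by (subst sum.swap) (simp add: mult.commute)
  also have "\<dots> = (\<Sum>k\<in>E. ip (g (f k)) k)"
    by (simp only: *[OF g])
  finally show ?thesis .
qed

end

locale lck_lie = lie_inner br ip for br :: "'a::real_vector \<Rightarrow> 'a \<Rightarrow> 'a" and ip +
  fixes J :: "'a \<Rightarrow> 'a" and \<theta> :: "'a \<Rightarrow> real"
  assumes lck: "lck_structure br J ip \<theta>"
begin

lemma linear_J: "linear J"
  using lck by (simp add: lck_structure_def complex_structure_def)

lemma linear_\<theta>: "linear \<theta>"
  using lck by (simp add: lck_structure_def)

lemmas J_simps = linear_add[OF linear_J] linear_diff[OF linear_J] linear_neg[OF linear_J]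
  linear_0[OF linear_J] linear_scale[OF linear_J]

lemma J_J [simp]: "J (J x) = - x"
  using lck by (simp add: lck_structure_def complex_structure_def)

lemma ip_JJ [simp]: "ip (J x) (J y) = ip x y"
  using lck by (simp add: lck_structure_def hermitian_def)

lemma ip_J_right: "ip x (J y) = - ip (J x) y"
  using ip_JJ[of x "J y"] by (simp add: ip_simps)

lemma ip_J_same [simp]: "ip (J x) x = 0"
  using ip_J_right[of x x] ip_sym[of x "J x"] by simp

lemma nijenhuis: "br (J x) (J y) = br x y + J (br (J x) y) + J (br x (J y))"
  using lck by (simp add: lck_structure_def complex_structure_def J_simps algebra_simps)

lemma \<theta>_closed: "\<theta> (br x y) = 0"
  using lck by (simp add: lck_structure_def ce_d1_def)

lemma d_\<omega>: "- ip (J (br x y)) z + ip (J (br x z)) y - ip (J (br y z)) x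
    = \<theta> x * ip (J y) z - \<theta> y * ip (J x) z + \<theta> z * ip (J x) y"
  using lck by (simp add: lck_structure_def ce_d2_def wedge12_def fundamental_form_def)

section \<open>The Lee vector and the sum of the brackets of e and J e\<close>

definition lee :: 'a where
  "lee = (THE v. \<forall>z. ip v z = \<theta> z)"

lemma ip_lee: "ip lee z = \<theta> z"
  using theI'[OF inner_product_riesz[OF fd ip linear_\<theta>]] by (simp add: lee_def)

lemma sum_onb_J:
  assumes "bilinear \<phi>" "onb E"
  shows "(\<Sum>e\<in>E. \<phi> (J e) (J e)) = (\<Sum>e\<in>E. \<phi> e e :: real)"
  using assms by (rule sum_onb_isometry[where V = "\<lambda>x. - J x"]) (simp_all add: linear_J J_simps)

lemma trace_br:
  assumes "unimodular br" "onb E"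
  shows "(\<Sum>e\<in>E. ip (br x e) e) = 0"
  using assms op_trace_onb[OF linear_br assms(2)] by (simp add: unimodular_def)

lemma sum_br_J:
  assumes uni: "unimodular br" and E: "onb E"
  shows "(\<Sum>e\<in>E. br e (J e)) = (real (card E) - 2) *\<^sub>R J lee"
proof -
  define v where "v = (\<Sum>e\<in>E. br e (J e))"
  have "ip (J v) w = ip (- (real (card E) - 2) *\<^sub>R lee) w" for w
  proof -
    \<comment> \<open>This is \<open>d_\<omega>\<close> at (e, J e, w). Summed over the basis, the
      two bracket terms are traces of \<open>br w\<close> up to sign and vanish. The remaining terms
      give -dim + 2: one \<open>\<theta> w\<close> per basis vector, against two Parseval
      sums.\<close>
    have pt: "ip (J (br e (J e))) w =
      ip (br (J e) w) (J e) + ip (br e w) e - \<theta> w + ip lee e * ip w e + ip lee (J e) * ip w (J e)"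
      if "e \<in> E" for e
    proof -
      have "ip e e = 1" using E that by (simp add: onb_def orthonormal_def)
      then show ?thesis
        using d_\<omega>[of e "J e" w] ip_J_right[of "br e w" e] ip_J_right[of "br (J e) w" e]
        by (simp add: ip_simps ip_lee ip_sym[of w e] ip_sym[of w "J e"])
    qed
    have "bilinear (\<lambda>a b. ip (br a w) b)"
      unfolding bilinear_def using linear_compose[OF linear_br_left linear_ip_left]
      by (simp add: linear_ip o_def)
    then have 1: "(\<Sum>e\<in>E. ip (br (J e) w) (J e)) = (\<Sum>e\<in>E. ip (br e w) e)"
      by (rule sum_onb_J[OF _ E])
    have 2: "(\<Sum>e\<in>E. ip (br e w) e) = 0"
      using trace_br[OF uni E, of w] by (subst br_skew) (simp add: ip_simps sum_negf)
    have "bilinear (\<lambda>a b. ip lee a * ip w b)"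
      unfolding bilinear_def by (auto intro!: linearI simp: ip_simps algebra_simps)
    from sum_onb_J[OF this E] have 3: "(\<Sum>e\<in>E. ip lee (J e) * ip w (J e)) = \<theta> w"
      using parseval[OF E, of lee w] by (simp add: ip_lee)
    have "ip (J v) w = (\<Sum>e\<in>E. ip (J (br e (J e))) w)"
      by (simp add: v_def linear_sum[OF linear_J] linear_sum[OF linear_ip_left])
    also have "\<dots> = (\<Sum>e\<in>E. ip (br (J e) w) (J e)) + (\<Sum>e\<in>E. ip (br e w) e)
        - (\<Sum>e\<in>E. \<theta> w) + (\<Sum>e\<in>E. ip lee e * ip w e) + (\<Sum>e\<in>E. ip lee (J e) * ip w (J e))"
      unfolding sum.distrib[symmetric] sum_subtractf[symmetric] by (intro sum.cong refl pt)
    also have "\<dots> = - real (card E) * \<theta> w + 2 * \<theta> w"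
      using 1 2 3 parseval[OF E, of lee w] by (simp add: ip_lee)
    finally show ?thesis
      by (simp add: ip_simps ip_lee algebra_simps)
  qed
  then have "J v = - (real (card E) - 2) *\<^sub>R lee" by (rule ip_ext)
  then have "J (J v) = J (- (real (card E) - 2) *\<^sub>R lee)" by simp
  then have "- v = - ((real (card E) - 2) *\<^sub>R J lee)"
    by (simp only: J_J linear_scale[OF linear_J] linear_neg[OF linear_J] scaleR_minus_left)
  then show ?thesis
    unfolding neg_equal_iff_equal v_def .
qed

section \<open>The Levi-Civita connection\<close>

abbreviation nabla :: "'a \<Rightarrow> 'a \<Rightarrow> 'a" where
  "nabla \<equiv> levi_civita br ip"

lemma koszul: "ip (nabla x y) z = (ip (br x y) z - ip (br y z) x + ip (br z x) y) / 2"
  by (rule levi_civita_koszul[OF real_lie_algebra_axioms ip])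

lemma bilinear_nabla: "bilinear nabla"
  unfolding bilinear_def
  by (intro conjI allI linearI ip_ext) (simp_all add: koszul ip_simps br_simps field_simps)

lemma torsion_free: "nabla x y - nabla y x = br x y"
proof (rule ip_ext)
  fix z
  show "ip (nabla x y - nabla y x) z = ip (br x y) z"
    using br_skew[of y x] br_skew[of z x] br_skew[of z y]
    by (simp add: koszul ip_simps field_simps)
qed

lemma nabla_skew: "ip (nabla x y) z = - ip y (nabla x z)"
proof -
  have "ip y (nabla x z) = ip (nabla x z) y" by (rule ip_sym)
  then show ?thesis
    using br_skew[of z y] br_skew[of y x] br_skew[of z x] by (simp add: koszul ip_simps field_simps)
qed

text \<open>
  For integrable \<open>J\<close> one has \<open>2 \<langle>(\<nabla>\<^sub>x J) y, z\<rangle> = d\<omega>(x, y, z) - d\<omega>(x, Jy, Jz)\<close>.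
\<close>

lemma nabla_J:
  "2 * ip (nabla x (J y) - J (nabla x y)) z =
    - \<theta> y * ip (J x) z + \<theta> z * ip (J x) y + \<theta> (J y) * ip x z - \<theta> (J z) * ip x y"
proof -
  have "2 * ip (nabla x (J y) - J (nabla x y)) z
    = 2 * ip (nabla x (J y)) z + 2 * ip (nabla x y) (J z)"
    by (simp add: ip_simps ip_J_right)
  also have "\<dots> = (- ip (J (br x y)) z + ip (J (br x z)) y - ip (J (br y z)) x)
     - (- ip (J (br x (J y))) (J z) + ip (J (br x (J z))) (J y) - ip (J (br (J y) (J z))) x)"
    using br_skew[of z x] br_skew[of "J z" x]
    unfolding koszul nijenhuis by (simp add: ip_simps J_simps ip_J_right field_simps)
  also have "\<dots> = - \<theta> y * ip (J x) z + \<theta> z * ip (J x) y + \<theta> (J y) * ip x z - \<theta> (J z) * ip x y"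
    unfolding d_\<omega> by (simp add: ip_simps ip_J_right[of y z])
  finally show ?thesis .
qed

end

section \<open>Unimodular solvable Kaehler Lie algebras\<close>

lemma sum_rotate:
  fixes f :: "'a \<Rightarrow> 'a \<Rightarrow> 'a \<Rightarrow> 'b::comm_monoid_add"
  shows "(\<Sum>i\<in>E. \<Sum>j\<in>E. \<Sum>k\<in>E. f j k i) = (\<Sum>i\<in>E. \<Sum>j\<in>E. \<Sum>k\<in>E. f i j k)"
proof -
  have "(\<Sum>i\<in>E. \<Sum>j\<in>E. \<Sum>k\<in>E. f j k i) = (\<Sum>j\<in>E. \<Sum>i\<in>E. \<Sum>k\<in>E. f j k i)"
    by (rule sum.swap)
  also have "\<dots> = (\<Sum>j\<in>E. \<Sum>k\<in>E. \<Sum>i\<in>E. f j k i)"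
    by (intro sum.cong refl sum.swap)
  finally show ?thesis .
qed

text \<open>Kaehler means locally conformally Kaehler with Lee form 0: \<open>d_\<omega>\<close>
  then says that the fundamental form is closed, and \<open>sum_br_J\<close> and
  \<open>nabla_J\<close> carry over with \<open>lee = 0\<close>.\<close>

locale kaehler_lie = lck_lie br ip J "\<lambda>_. 0" for br :: "'a::real_vector \<Rightarrow> 'a \<Rightarrow> 'a" and ip J
begin

lemma nabla_J_commute: "nabla x (J y) = J (nabla x y)"
proof -
  have "ip (nabla x (J y) - J (nabla x y)) z = ip 0 z" for z
    using nabla_J[of x y z] by (simp add: ip_simps)
  then have "nabla x (J y) - J (nabla x y) = 0" by (rule ip_ext)
  then show ?thesis by simp
qed

lemmas nabla_simps = bilinear_ladd[OF bilinear_nabla] bilinear_radd[OF bilinear_nabla]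
  bilinear_lmul[OF bilinear_nabla] bilinear_rmul[OF bilinear_nabla] bilinear_lneg[OF bilinear_nabla]
  bilinear_rneg[OF bilinear_nabla] bilinear_lzero[OF bilinear_nabla]
  bilinear_rzero[OF bilinear_nabla] bilinear_lsub[OF bilinear_nabla] bilinear_rsub[OF bilinear_nabla]

lemma linear_nabla: "linear (nabla x)"
  using bilinear_nabla by (simp add: bilinear_def)

lemma linear_nabla_left: "linear (\<lambda>x. nabla x y)"
  using bilinear_nabla by (simp add: bilinear_def)

definition curv :: "'a \<Rightarrow> 'a \<Rightarrow> 'a \<Rightarrow> 'a" where
  "curv x y z = nabla x (nabla y z) - nabla y (nabla x z) - nabla (br x y) z"

lemmas curv_simps = nabla_simps br_simps J_simps ip_simps

text \<open>Applying \<open>torsion_free\<close> twice turns the cyclic sum into the cyclic sum of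
  double brackets, which is 0 by \<open>jacobi\<close>.\<close>

lemma bianchi: "curv x y z + curv y z x + curv z x y = 0"
proof -
  have "curv x y z + curv y z x + curv z x y =
    nabla x (nabla y z - nabla z y) + nabla y (nabla z x - nabla x z) + nabla z (nabla x y - nabla y x)
     - nabla (br x y) z - nabla (br y z) x - nabla (br z x) y"
    by (simp add: curv_def nabla_simps algebra_simps)
  also have "\<dots> = (nabla x (br y z) - nabla (br y z) x) + (nabla y (br z x) - nabla (br z x) y)
     + (nabla z (br x y) - nabla (br x y) z)"
    by (simp only: torsion_free[of y z] torsion_free[of z x] torsion_free[of x y])
      (simp add: algebra_simps)
  also have "\<dots> = 0"
    unfolding torsion_free by (rule jacobi)
  finally show ?thesis .
qed

lemma curv_J: "curv x y (J z) = J (curv x y z)"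
  by (simp add: curv_def nabla_J_commute J_simps)

lemma curv_skew: "ip (curv x y z) w = - ip z (curv x y w)"
  using nabla_skew by (simp add: curv_def ip_simps)

lemma curv_minus: "curv x y (- z) = - curv x y z"
  by (simp add: curv_def curv_simps)

lemma bilinear_curv: "bilinear (\<lambda>a b. ip (curv a y (J b)) w)"
  unfolding bilinear_def by (auto intro!: linearI simp: curv_def curv_simps algebra_simps)

text \<open>
  The sum of \<open>\<langle>R(i, Ji) j, Jj\<rangle>\<close> over an orthonormal basis vanishes because the trace of a
  commutator is 0 and \<open>\<Sum> [i, Ji] = 0\<close>; by the Bianchi identity it is \<open>-2\<close> times the scalar
  curvature.
\<close>

lemma scalar_curvature_eq_0:
  assumes uni: "unimodular br" and E: "onb E"
  shows "(\<Sum>i\<in>E. \<Sum>j\<in>E. ip (curv i j j) i) = 0"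
proof -
  let ?s = "\<Sum>i\<in>E. \<Sum>j\<in>E. ip (curv i j j) i"
  have "(\<Sum>j\<in>E. ip (curv i (J i) j) (J j)) = - (\<Sum>j\<in>E. ip (nabla (br i (J i)) j) (J j))" for i
  proof -
    \<comment> \<open>As \<open>J\<close> commutes with \<open>nabla\<close>, both second-order
      terms of \<open>curv i (J i)\<close> have the same trace against \<open>J\<close> and
      cancel.\<close>
    have "(\<Sum>j\<in>E. ip (nabla i (J (nabla (J i) j))) j) = (\<Sum>j\<in>E. ip (J (nabla (J i) (nabla i j))) j)"
      using sum_ip_comp_commute[OF E linear_nabla[of i] linear_compose[OF linear_nabla[of "J i"] linear_J]]
      by (simp add: o_def)
    then have "(\<Sum>j\<in>E. ip (nabla i (nabla (J i) j)) (J j)) = (\<Sum>j\<in>E. ip (nabla (J i) (nabla i j)) (J j))"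
      by (simp add: ip_J_right nabla_J_commute sum_negf)
    then show ?thesis
      by (simp add: curv_def ip_simps sum_subtractf)
  qed
  then have "(\<Sum>i\<in>E. \<Sum>j\<in>E. ip (curv i (J i) j) (J j))
     = - (\<Sum>j\<in>E. \<Sum>i\<in>E. ip (nabla (br i (J i)) j) (J j))"
    by (subst sum.swap[of _ E E]) (simp add: sum_negf)
  also have "\<dots> = - (\<Sum>j\<in>E. ip (nabla (\<Sum>i\<in>E. br i (J i)) j) (J j))"
    by (simp add: linear_sum[OF linear_nabla_left] linear_sum[OF linear_ip_left])
  also have "\<dots> = 0"
  proof -
    have "lee = 0" using ip_lee[of lee] by simp
    then show ?thesis
      unfolding sum_br_J[OF uni E] by (simp add: curv_simps)
  qed
  finally have 0: "(\<Sum>i\<in>E. \<Sum>j\<in>E. ip (curv i (J i) j) (J j)) = 0" .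
  have a: "(\<Sum>i\<in>E. \<Sum>j\<in>E. ip (curv j i (J i)) (J j)) = ?s"
    by (subst sum.swap) (simp add: curv_J)
  \<comment> \<open>Replacing the basis vectors \<open>i\<close> by \<open>J i\<close> leaves the
    trace of the form in \<open>bilinear_curv\<close> unchanged. One sign comes from J J = -1, the
    other from the skewness of the curvature.\<close>
  have b: "(\<Sum>i\<in>E. \<Sum>j\<in>E. ip (curv (J i) j i) (J j)) = ?s"
  proof -
    have "(\<Sum>i\<in>E. ip (curv (J i) j i) (J j)) = (\<Sum>i\<in>E. ip (curv i j j) i)" for j
    proof -
      have "(\<Sum>i\<in>E. ip (curv (J i) j (J (J i))) (J j)) = (\<Sum>i\<in>E. ip (curv i j (J i)) (J j))"
        by (rule sum_onb_J[OF bilinear_curv E])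
      also have "\<dots> = (\<Sum>i\<in>E. - ip (curv i j j) i)"
        by (simp add: curv_J) (use curv_skew ip_sym in metis)
      finally show ?thesis
        by (simp add: curv_minus curv_simps sum_negf)
    qed
    then show ?thesis
      by (subst (1 2) sum.swap) simp
  qed
  have "(\<Sum>i\<in>E. \<Sum>j\<in>E. ip (curv i (J i) j) (J j)) =
      - (\<Sum>i\<in>E. \<Sum>j\<in>E. ip (curv (J i) j i) (J j)) - (\<Sum>i\<in>E. \<Sum>j\<in>E. ip (curv j i (J i)) (J j))"
    unfolding sum_negf[symmetric] sum_subtractf[symmetric]
  proof (intro sum.cong refl)
    fix i j
    have "curv i (J i) j = - curv (J i) j i - curv j i (J i)"
      using bianchi[of i "J i" j] by (simp add: eq_diff_eq eq_neg_iff_add_eq_0 ac_simps)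
    then show "ip (curv i (J i) j) (J j) = - ip (curv (J i) j i) (J j) - ip (curv j i (J i)) (J j)"
      by (simp add: ip_simps)
  qed
  then show ?thesis using 0 a b by simp
qed

text \<open>
  The left-hand side is \<open>-4\<close> times the scalar curvature.
\<close>

lemma bracket_killing_sum:
  assumes uni: "unimodular br" and E: "onb E"
  shows "(\<Sum>i\<in>E. \<Sum>j\<in>E. ip (br i j) (br i j)) + 2 * (\<Sum>i\<in>E. \<Sum>j\<in>E. ip (br i (br i j)) j) = 0"
proof -
  define S where "S = (\<Sum>i\<in>E. \<Sum>j\<in>E. ip (br i j) (br i j))"
  define T where "T = (\<Sum>i\<in>E. \<Sum>j\<in>E. ip (br i (br i j)) j)"
  define Q where "Q = (\<Sum>i\<in>E. \<Sum>j\<in>E. ip (nabla i j) (nabla i j))"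
  define c where "c i j k = ip (br i j) k" for i j k
  have T': "(\<Sum>i\<in>E. \<Sum>j\<in>E. ip (br j (br j i)) i) = T"
    unfolding T_def by (rule sum.swap)
  have Q': "(\<Sum>i\<in>E. \<Sum>j\<in>E. ip (nabla j i) (nabla j i)) = Q"
    unfolding Q_def by (rule sum.swap)
  \<comment> \<open>Unimodularity enters again: the pairing of \<Sum> \<open>nabla j j\<close> with
    x is the trace of \<open>br x\<close>.\<close>
  have 1: "(\<Sum>i\<in>E. \<Sum>j\<in>E. ip (nabla i (nabla j j)) i) = 0"
  proof -
    have "ip (\<Sum>j\<in>E. nabla j j) x = 0" for x
    proof -
      have "ip (nabla j j) x = ip (br x j) j" for j
        using br_skew[of j x] by (simp add: koszul alternating curv_simps)
      then show ?thesis
        using trace_br[OF uni E, of x] by (simp add: linear_sum[OF linear_ip_left])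
    qed
    then have "(\<Sum>j\<in>E. nabla j j) = 0" using ip_eq_0_iff by blast
    moreover have "(\<Sum>j\<in>E. ip (nabla i (nabla j j)) i) = ip (nabla i (\<Sum>j\<in>E. nabla j j)) i" for i
      by (simp add: linear_sum[OF linear_nabla] linear_sum[OF linear_ip_left])
    ultimately show ?thesis by (simp add: curv_simps)
  qed
  have 2: "(\<Sum>i\<in>E. \<Sum>j\<in>E. ip (nabla (br i j) j) i) = S / 2 + T"
  proof -
    have *: "2 * ip (nabla (br i j) j) i
      = ip (br i j) (br i j) + ip (br i (br i j)) j + ip (br j (br j i)) i" for i j
      using br_skew[of "br i j" j] br_skew[of j i] by (simp add: koszul curv_simps)
    have "2 * (\<Sum>i\<in>E. \<Sum>j\<in>E. ip (nabla (br i j) j) i) = S + T + T"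
      by (subst (2) T'[symmetric]) (simp only: sum_distrib_left * sum.distrib S_def T_def)
    then show ?thesis by simp
  qed
  \<comment> \<open>Polarization: by \<open>torsion_free\<close> the squared norm of
    \<open>nabla i j - nabla j i\<close> is that of \<open>br i j\<close>.\<close>
  have 3: "(\<Sum>i\<in>E. \<Sum>j\<in>E. ip (nabla i j) (nabla j i)) = Q - S / 2"
  proof -
    have *: "2 * ip (nabla i j) (nabla j i)
      = ip (nabla i j) (nabla i j) + ip (nabla j i) (nabla j i) - ip (br i j) (br i j)" for i j
      using ip_sym[of "nabla i j" "nabla j i"]
      by (simp add: torsion_free[symmetric] ip_simps)
    have "2 * (\<Sum>i\<in>E. \<Sum>j\<in>E. ip (nabla i j) (nabla j i)) = Q + Q - S"
      by (subst (2) Q'[symmetric])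
        (simp only: sum_distrib_left * sum.distrib sum_subtractf S_def Q_def)
    then show ?thesis by simp
  qed
  have X: "(\<Sum>i\<in>E. \<Sum>j\<in>E. \<Sum>k\<in>E. c i j k * c j k i) = - T"
  proof -
    have "(\<Sum>k\<in>E. c i j k * c j k i) = - ip (br j (br j i)) i" for i j
    proof -
      have "(\<Sum>k\<in>E. c i j k * c j k i) = ip (br j (\<Sum>k\<in>E. ip (br i j) k *\<^sub>R k)) i"
        by (simp add: c_def linear_sum[OF linear_br] linear_sum[OF linear_ip_left] curv_simps)
      also have "\<dots> = - ip (br j (br j i)) i"
        unfolding onb_expand[OF E] br_skew[of i j] by (simp add: curv_simps)
      finally show ?thesis .
    qed
    then show ?thesis by (simp add: T' sum_negf)
  qed
  have S3: "(\<Sum>i\<in>E. \<Sum>j\<in>E. \<Sum>k\<in>E. c i j k * c i j k) = S"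
    by (simp add: S_def c_def parseval[OF E])
  \<comment> \<open>By Koszul, twice a component of \<open>nabla i j\<close> is a signed sum of
    three cyclic structure constants. The three squares each sum to S. The cross terms, with signs
    -, +, -, each sum to -T up to the factor 2, so 4 Q = 3 S + 2 T.\<close>
  have 4: "Q = (3 * S + 2 * T) / 4"
  proof -
    have *: "4 * ip (nabla i j) (nabla i j) = (\<Sum>k\<in>E. c i j k * c i j k + c j k i * c j k i + c k i j * c k i j
        - 2 * (c i j k * c j k i) + 2 * (c k i j * c i j k) - 2 * (c j k i * c k i j))" for i j
    proof -
      have "4 * ip (nabla i j) (nabla i j) = (\<Sum>k\<in>E. (2 * ip (nabla i j) k) * (2 * ip (nabla i j) k))"
        unfolding parseval[OF E, of "nabla i j" "nabla i j", symmetric] sum_distrib_left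
        by (intro sum.cong refl) simp
      also have "\<dots> = (\<Sum>k\<in>E. c i j k * c i j k + c j k i * c j k i + c k i j * c k i j
        - 2 * (c i j k * c j k i) + 2 * (c k i j * c i j k) - 2 * (c j k i * c k i j))"
      proof (intro sum.cong refl)
        fix k
        have 2: "2 * ip (nabla i j) k = c i j k - c j k i + c k i j"
          by (simp add: koszul c_def)
        show "(2 * ip (nabla i j) k) * (2 * ip (nabla i j) k) =
          c i j k * c i j k + c j k i * c j k i + c k i j * c k i j
          - 2 * (c i j k * c j k i) + 2 * (c k i j * c i j k) - 2 * (c j k i * c k i j)"
          unfolding 2 by (simp add: algebra_simps)
      qed
      finally show ?thesis .
    qed
    have "4 * Q = (\<Sum>i\<in>E. \<Sum>j\<in>E. 4 * ip (nabla i j) (nabla i j))"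
      by (simp only: Q_def sum_distrib_left)
    also have "\<dots> = S + S + S - 2 * (- T) + 2 * (- T) - 2 * (- T)"
      unfolding * sum.distrib sum_subtractf sum_distrib_left[symmetric]
      using S3 X sum_rotate[of "\<lambda>i j k. c i j k * c i j k" E]
        sum_rotate[of "\<lambda>i j k. c k i j * c k i j" E]
        sum_rotate[of "\<lambda>i j k. c i j k * c j k i" E]
        sum_rotate[of "\<lambda>i j k. c k i j * c i j k" E] by simp
    finally show ?thesis by simp
  qed
  have "0 = (\<Sum>i\<in>E. \<Sum>j\<in>E. ip (nabla i (nabla j j)) i + ip (nabla i j) (nabla j i) - ip (nabla (br i j) j) i)"
    unfolding scalar_curvature_eq_0[OF uni E, symmetric]
  proof (intro sum.cong refl)
    fix i j
    show "ip (curv i j j) i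
      = ip (nabla i (nabla j j)) i + ip (nabla i j) (nabla j i) - ip (nabla (br i j) j) i"
      using nabla_skew[of j "nabla i j" i] by (simp add: curv_def ip_simps)
  qed
  also have "\<dots> = - (S + 2 * T) / 4"
    using 1 2 3 4 by (simp add: sum.distrib sum_subtractf field_simps)
  finally show ?thesis by (simp add: S_def T_def)
qed

text \<open>
  The Killing form vanishes on the derived algebra, which turns the left-hand side of
  \<open>bracket_killing_sum\<close> into a sum of squares: of the brackets within the derived algebra and
  within its complement, and of the symmetric parts of \<open>br a\<close> on the derived algebra.
\<close>

lemma derived_structure:
  assumes uni: "unimodular br" and solv: "solvable br"
  shows "u \<in> derived_series br 1 \<Longrightarrow> v \<in> derived_series br 1 \<Longrightarrow> br u v = 0"
    and "u \<in> derived_series br 1 \<Longrightarrow> ip (br x u) u = 0"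
proof -
  let ?D = "derived_series br 1"
  have brD: "br x y \<in> ?D" for x y
    using br_derived_series[of x 0 y] by simp
  obtain N where N: "orthonormal N" "span N = ?D"
    using orthonormal_extend_subspace[OF orthonormal_empty subspace_derived_series] by blast
  obtain E where E: "N \<subseteq> E" "orthonormal E" "span E = UNIV"
    using orthonormal_extend_subspace[OF N(1) subspace_UNIV] by blast
  then have onb: "onb E" by (simp add: onb_def)
  have fin: "finite E" "finite N" using E N by (auto simp: orthonormal_def)
  have perp: "ip (br x y) a = 0" if "a \<in> E - N" for x y a
  proof -
    have "ip a w = 0" if "w \<in> N" for w
      using \<open>a \<in> E - N\<close> that E by (auto simp: orthonormal_def)
    then have "ip a (br x y) = 0"
      using linear_eq_0_on_span[OF linear_ip, of N a "br x y"] brD N(2) by blast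
    then show ?thesis by (simp add: ip_sym)
  qed
  define c where "c a j l = ip (br a j) l" for a j l
  have norm: "ip (br x y) (br x y) = (\<Sum>l\<in>N. c x y l * c x y l)" for x y
  proof -
    have "ip (br x y) (br x y) = (\<Sum>l\<in>E. c x y l * c x y l)"
      by (simp add: parseval[OF onb] c_def)
    also have "\<dots> = (\<Sum>l\<in>N. c x y l * c x y l)"
      using fin E(1) perp by (intro sum.mono_neutral_right) (auto simp: c_def)
    finally show ?thesis .
  qed
  have kill: "(\<Sum>j\<in>E. ip (br a (br a j)) j) = (\<Sum>j\<in>N. \<Sum>l\<in>N. c a j l * c a l j)" for a
  proof -
    have "(\<Sum>j\<in>E. ip (br a (br a j)) j) = (\<Sum>j\<in>N. ip (br a (br a j)) j)"
      using fin E(1) perp by (intro sum.mono_neutral_right) auto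
    also have "\<dots> = (\<Sum>j\<in>N. \<Sum>l\<in>N. c a j l * c a l j)"
    proof (rule sum.cong[OF refl])
      fix j
      have "br a j = proj N (br a j)" using proj_span[OF N(1)] N(2) brD by simp
      then have "ip (br a (br a j)) j = ip (br a (\<Sum>l\<in>N. ip (br a j) l *\<^sub>R l)) j"
        by (simp add: proj_def)
      also have "\<dots> = (\<Sum>l\<in>N. c a j l * c a l j)"
        by (simp add: c_def linear_sum[OF linear_br] linear_sum[OF linear_ip_left] curv_simps)
      finally show "ip (br a (br a j)) j = (\<Sum>l\<in>N. c a j l * c a l j)" .
    qed
    finally show ?thesis .
  qed
  have killN: "(\<Sum>j\<in>E. ip (br a (br a j)) j) = 0" if "a \<in> N" for a
  proof -
    have "a \<in> ?D" using that N(2) span_base by blast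
    then show ?thesis
      using trace_derived_eq_0[OF solv, of a a]
        op_trace_onb[OF linear_compose[OF linear_br linear_br] onb, of a a] by (simp add: o_def)
  qed
  \<comment> \<open>Twice the symmetric part of \<open>br a\<close> on the derived algebra, squared.
    Expanding gives P = 2 VN + 2 K, and these are exactly the terms of S + 2 T without a sign of
    their own, leaving VV + NN + P.\<close>
  define P where "P = (\<Sum>a\<in>E-N. \<Sum>j\<in>N. \<Sum>l\<in>N. (c a j l + c a l j)\<^sup>2)"
  define VV where "VV = (\<Sum>a\<in>E-N. \<Sum>b\<in>E-N. ip (br a b) (br a b))"
  define NN where "NN = (\<Sum>a\<in>N. \<Sum>b\<in>N. ip (br a b) (br a b))"
  define VN where "VN = (\<Sum>a\<in>E-N. \<Sum>b\<in>N. ip (br a b) (br a b))"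
  define K where "K = (\<Sum>a\<in>E-N. \<Sum>j\<in>N. \<Sum>l\<in>N. c a j l * c a l j)"
  have split: "sum f E = sum f (E - N) + sum f N" for f :: "'a \<Rightarrow> real"
    using sum.subset_diff[OF E(1) fin(1), of f] .
  have "(\<Sum>a\<in>E. \<Sum>b\<in>E. ip (br a b) (br a b)) = VV + VN + (\<Sum>a\<in>N. \<Sum>b\<in>E-N. ip (br a b) (br a b)) + NN"
    by (simp add: split sum.distrib VV_def VN_def NN_def)
  also have "(\<Sum>a\<in>N. \<Sum>b\<in>E-N. ip (br a b) (br a b)) = VN"
  proof -
    have "ip (br a b) (br a b) = ip (br b a) (br b a)" for a b
      using br_skew[of a b] by (simp add: ip_simps)
    then show ?thesis
      unfolding VN_def by (subst sum.swap) (intro sum.cong refl)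
  qed
  finally have S: "(\<Sum>a\<in>E. \<Sum>b\<in>E. ip (br a b) (br a b)) = VV + 2 * VN + NN" by simp
  have T: "(\<Sum>i\<in>E. \<Sum>j\<in>E. ip (br i (br i j)) j) = K"
    by (subst split) (simp add: killN K_def, simp add: kill)
  have "P = 2 * VN + 2 * K"
  proof -
    have "(\<Sum>j\<in>N. \<Sum>l\<in>N. (c a j l + c a l j)\<^sup>2)
       = 2 * (\<Sum>b\<in>N. ip (br a b) (br a b)) + 2 * (\<Sum>j\<in>N. \<Sum>l\<in>N. c a j l * c a l j)" for a
    proof -
      have "(\<Sum>j\<in>N. \<Sum>l\<in>N. (c a j l + c a l j)\<^sup>2) = (\<Sum>j\<in>N. \<Sum>l\<in>N. c a j l * c a j l)
         + (\<Sum>j\<in>N. \<Sum>l\<in>N. c a l j * c a l j) + 2 * (\<Sum>j\<in>N. \<Sum>l\<in>N. c a j l * c a l j)"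
        by (simp add: power2_eq_square algebra_simps sum.distrib sum_distrib_left)
      also have "(\<Sum>j\<in>N. \<Sum>l\<in>N. c a l j * c a l j) = (\<Sum>j\<in>N. \<Sum>l\<in>N. c a j l * c a j l)"
        by (rule sum.swap)
      finally show ?thesis by (simp add: norm)
    qed
    then show ?thesis
      by (simp add: P_def VN_def K_def sum.distrib sum_distrib_left)
  qed
  then have "VV + NN + P = 0"
    using bracket_killing_sum[OF uni onb] S T by simp
  moreover have "VV \<ge> 0" "NN \<ge> 0" "P \<ge> 0"
    unfolding VV_def NN_def P_def by (intro sum_nonneg ip_nonneg zero_le_power2)+
  ultimately have "NN = 0" "P = 0" by auto
  then have NN: "br a b = 0" if "a \<in> N" "b \<in> N" for a b
    using that fin(2) unfolding NN_def by (simp add: sum_nonneg_eq_0_iff ip_nonneg sum_nonneg)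
  have P: "c a j l + c a l j = 0" if "a \<in> E - N" "j \<in> N" "l \<in> N" for a j l
    using \<open>P = 0\<close> that fin unfolding P_def by (simp add: sum_nonneg_eq_0_iff sum_nonneg)
  have skewN: "ip (br a u) v + ip (br a v) u = 0" if a: "a \<in> E" and uv: "u \<in> N" "v \<in> N" for a u v
    using NN[of a u] NN[of a v] P[of a u v] that by (cases "a \<in> N") (auto simp: c_def curv_simps)
  have skew: "ip (br x u) v + ip (br x v) u = 0" if "u \<in> ?D" "v \<in> ?D" for x u v
  proof -
    have lin: "linear (\<lambda>u. ip (br x u) v + ip (br x v) u)" "linear (\<lambda>x. ip (br x u) v + ip (br x v) u)"
      "linear (\<lambda>v. ip (br x u) v + ip (br x v) u)" for x u v
      by (auto intro!: linearI simp: curv_simps algebra_simps)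
    have 1: "ip (br x u) v + ip (br x v) u = 0" if "u \<in> N" "v \<in> N" for x u v
      using linear_eq_0_on_span[OF lin(2), of E u v x] E(3) skewN that by auto
    have 2: "ip (br x u) v + ip (br x v) u = 0" if "u \<in> N" for x u
      using linear_eq_0_on_span[OF lin(3), of N x u v] 1 that \<open>v \<in> ?D\<close> N(2) by blast
    show ?thesis
      using linear_eq_0_on_span[OF lin(1), of N x v u] 2 \<open>u \<in> ?D\<close> N(2) by blast
  qed
  show "br u v = 0" if "u \<in> ?D" "v \<in> ?D"
  proof -
    have "br a v = 0" if "a \<in> N" for a
      using linear_eq_0_on_span[OF linear_br, of N a v] NN that \<open>v \<in> ?D\<close> N(2) by blast
    then show ?thesis
      using linear_eq_0_on_span[OF linear_br_left, of N v u] \<open>u \<in> ?D\<close> N(2) by blast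
  qed
  show "ip (br x u) u = 0" if "u \<in> ?D"
    using skew[OF that that, of x] by simp
qed

end

section \<open>Vaisman Lie algebras\<close>

lemma complex_eigenvalue_iff:
  "complex_eigenvalue f \<mu> \<longleftrightarrow> (\<exists>p q. (p \<noteq> 0 \<or> q \<noteq> 0) \<and>
     f p = Re \<mu> *\<^sub>R p - Im \<mu> *\<^sub>R q \<and> f q = Re \<mu> *\<^sub>R q + Im \<mu> *\<^sub>R p)"
  by (auto simp: complex_eigenvalue_def cscale_def zero_prod_def)

text \<open>Multiplication of f w = \<mu> w by the conjugate of \<mu>, with w = p + i q. For \<mu>
  nonzero it expresses p and q through values of f.\<close>

lemma complex_eigenvector_norm:
  fixes p q u v :: "'a::real_vector"
  assumes "u = a *\<^sub>R p - b *\<^sub>R q" "v = a *\<^sub>R q + b *\<^sub>R p"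
  shows "(a\<^sup>2 + b\<^sup>2) *\<^sub>R p = a *\<^sub>R u + b *\<^sub>R v" "(a\<^sup>2 + b\<^sup>2) *\<^sub>R q = a *\<^sub>R v - b *\<^sub>R u"
  by (simp_all add: assms power2_eq_square algebra_simps)

context kaehler_lie
begin

lemma imaginary_eigenvalues:
  assumes uni: "unimodular br" and solv: "solvable br" and ev: "complex_eigenvalue (br x) \<mu>"
  shows "Re \<mu> = 0"
proof (rule ccontr)
  assume "Re \<mu> \<noteq> 0"
  define a b where "a = Re \<mu>" and "b = Im \<mu>"
  obtain p q where pq: "p \<noteq> 0 \<or> q \<noteq> 0" "br x p = a *\<^sub>R p - b *\<^sub>R q" "br x q = a *\<^sub>R q + b *\<^sub>R p"
    using ev by (auto simp: complex_eigenvalue_iff a_def b_def)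
  let ?D = "derived_series br 1"
  have D: "subspace ?D" by (rule subspace_derived_series)
  have brD: "br x y \<in> ?D" for y
    using br_derived_series[of x 0 y] by simp
  have "(a\<^sup>2 + b\<^sup>2) *\<^sub>R p \<in> ?D" "(a\<^sup>2 + b\<^sup>2) *\<^sub>R q \<in> ?D"
    unfolding complex_eigenvector_norm[OF pq(2,3)]
    by (intro subspace_add[OF D] subspace_diff[OF D] subspace_scale[OF D] brD)+
  moreover have "a\<^sup>2 + b\<^sup>2 \<noteq> 0"
    using \<open>Re \<mu> \<noteq> 0\<close> by (simp add: a_def sum_power2_eq_zero_iff)
  ultimately have "p \<in> ?D" "q \<in> ?D"
    using subspace_scale[OF D, of _ "inverse (a\<^sup>2 + b\<^sup>2)"] by fastforce+
  then have "ip (br x p) p + ip (br x q) q = 0"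
    using derived_structure(2)[OF uni solv] by simp
  \<comment> \<open>The terms with \<open>b\<close> cancel by symmetry of \<open>ip\<close>; this is
    the real part of the Hermitian pairing of the eigenvector with its image.\<close>
  then have "a * (ip p p + ip q q) = 0"
    unfolding pq(2,3) by (simp add: ip_simps ip_sym[of q p] algebra_simps)
  then have "ip p p + ip q q = 0"
    using \<open>Re \<mu> \<noteq> 0\<close> by (simp add: a_def)
  then show False
    using ip_nonneg[of p] ip_nonneg[of q] pq(1) by (simp add: add_nonneg_eq_0_iff)
qed

end

locale vaisman_lie = lck_lie br ip J \<theta> for br :: "'a::real_vector \<Rightarrow> 'a \<Rightarrow> 'a" and ip J \<theta> +
  assumes parallel: "nabla_form br ip \<theta> x y = 0"
    and nonzero: "\<exists>x. \<theta> x \<noteq> 0"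
    and uni: "unimodular br" and solv: "solvable br"
begin

definition \<xi> :: 'a where "\<xi> = J lee"

definition lee_sq :: real where "lee_sq = ip lee lee"

lemma lee_nonzero: "lee \<noteq> 0"
  using nonzero ip_lee by (auto simp: ip_simps)

lemma lee_sq_pos: "lee_sq > 0"
  using ip_pos[OF lee_nonzero] by (simp add: lee_sq_def)

lemma \<theta>_lee: "\<theta> lee = lee_sq"
  by (simp add: lee_sq_def ip_lee)

lemma \<xi>_norm: "ip \<xi> \<xi> = lee_sq"
  by (simp add: \<xi>_def lee_sq_def)

lemma J_\<xi>: "J \<xi> = - lee"
  by (simp add: \<xi>_def)

lemma ip_\<xi>: "ip \<xi> x = - \<theta> (J x)"
  using ip_J_right[of lee x] by (simp add: \<xi>_def ip_lee)

lemma \<theta>_J: "\<theta> (J x) = - ip \<xi> x"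
  by (simp add: ip_\<xi>)

lemma ip_\<xi>_J: "ip \<xi> (J x) = \<theta> x"
  by (simp add: \<xi>_def ip_lee)

text \<open>Parallelism of \<theta> makes \<open>lee\<close> a parallel vector, so only one term of
  the torsion identity survives. The properties of \<open>nabla lee\<close> thereby pass to
  \<open>br lee\<close>.\<close>

lemma br_lee: "br lee y = nabla lee y"
proof -
  have "nabla y lee = 0"
  proof (rule ip_ext)
    fix z
    have "ip lee (nabla y z) = 0"
      using parallel[of y z] by (simp add: nabla_form_def ip_lee)
    then show "ip (nabla y lee) z = ip 0 z"
      by (simp add: nabla_skew ip_simps)
  qed
  then show ?thesis
    using torsion_free[of lee y] by simp
qed

lemma br_lee_skew: "ip (br lee y) z = - ip y (br lee z)"
  by (simp add: br_lee nabla_skew)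

text \<open>For x = \<open>lee\<close> the right-hand side of \<open>nabla_J\<close> cancels
  identically.\<close>

lemma br_lee_J: "br lee (J y) = J (br lee y)"
proof -
  have "br lee (J y) - J (br lee y) = 0"
  proof (rule ip_ext)
    fix z
    have "ip (J lee) w = - \<theta> (J w)" for w
      using ip_\<xi> by (simp add: \<xi>_def)
    then show "ip (br lee (J y) - J (br lee y)) z = ip 0 z"
      using nabla_J[of lee y z] by (simp add: br_lee ip_lee ip_simps)
  qed
  then show ?thesis by simp
qed

lemma br_lee_\<xi>: "br lee \<xi> = 0"
  by (simp add: \<xi>_def br_lee_J alternating J_simps)

text \<open>Evaluate \<open>d_\<omega>\<close> at \<open>lee\<close>: J composed with
  \<open>br lee\<close> is symmetric, so two of the three bracket terms cancel. The formula
  determines the \<xi>-component of every bracket, which the quotient construction has to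
  remove.\<close>

lemma ip_\<xi>_br: "ip \<xi> (br y z) = lee_sq * ip (J y) z - \<theta> y * ip \<xi> z + \<theta> z * ip \<xi> y"
proof -
  have "ip (J (br lee z)) y = - ip (J z) (br lee y)"
    using br_lee_skew[of "J z" y] by (simp add: br_lee_J)
  also have "\<dots> = ip (J (br lee y)) z"
    using ip_J_right[of "br lee y" z] ip_sym[of "J z"] by simp
  finally have "ip (J (br lee z)) y = ip (J (br lee y)) z" .
  moreover have "ip (J (br y z)) lee = - ip \<xi> (br y z)"
    using ip_J_right[of "br y z" lee] ip_sym[of "br y z" "J lee"] by (simp add: \<xi>_def)
  ultimately show ?thesis
    using d_\<omega>[of lee y z] by (simp add: \<theta>_lee \<xi>_def)
qed

text \<open>In \<open>nijenhuis\<close> at (\<open>lee\<close>, y) the terms with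
  \<open>br lee\<close> cancel by \<open>br_lee_J\<close>.\<close>

lemma br_\<xi>_J: "br \<xi> (J y) = J (br \<xi> y)"
  using nijenhuis[of lee y] by (simp add: \<xi>_def br_lee_J)

text \<open>\<open>d_\<omega>\<close> at \<xi> shows that J composed with \<open>br \<xi>\<close> is
  symmetric, the term with [y, z] vanishing because \<theta> is closed. Together with
  \<open>br_\<xi>_J\<close> this is skewness.\<close>

lemma br_\<xi>_skew: "ip (br \<xi> y) z = - ip y (br \<xi> z)"
proof -
  have *: "ip (J (br \<xi> y)) z = ip (J (br \<xi> z)) y" for y z
    using d_\<omega>[of \<xi> y z] \<theta>_J[of lee] ip_JJ[of "br y z" lee] ip_sym[of "br y z" lee]
    by (simp add: J_\<xi> ip_simps ip_lee \<theta>_closed)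
      (simp add: \<xi>_def ip_sym[of "J (br y z)"] ip_lee \<theta>_closed)
  have "ip (br \<xi> y) z = - ip (J (br \<xi> (J y))) z"
    by (simp add: br_\<xi>_J ip_simps)
  also have "\<dots> = - ip (J (br \<xi> z)) (J y)"
    by (simp only: *)
  also have "\<dots> = - ip y (br \<xi> z)"
    by (simp add: ip_sym)
  finally show ?thesis .
qed

lemma \<xi>_central: "br \<xi> x = 0"
proof -
  define a b where "a = (1 / sqrt lee_sq) *\<^sub>R lee" and "b = (1 / sqrt lee_sq) *\<^sub>R \<xi>"
  have ab: "ip a a = 1" "ip b b = 1" "ip a b = 0" "ip b a = 0"
    using lee_sq_pos ip_J_same[of lee] ip_sym[of lee "J lee"]
    by (simp_all add: a_def b_def ip_simps \<xi>_norm) (simp_all add: lee_sq_def \<xi>_def)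
  then have "a \<noteq> b" by auto
  have "orthonormal {a, b}"
    using ab by (auto simp: orthonormal_def)
  then obtain E where E: "{a, b} \<subseteq> E" "orthonormal E" "span E = UNIV"
    using orthonormal_extend_subspace[OF _ subspace_UNIV] by blast
  then have onb: "onb E" and fin: "finite E"
    by (auto simp: onb_def orthonormal_def)
  have "br \<xi> e = 0" if e: "e \<in> E" for e
  proof (cases "card E = 2")
    \<comment> \<open>In dimension 2 the factor dim - 2 vanishes and \<open>sum_br_J\<close> says
      nothing about \<xi>; but then \<open>lee\<close> and \<xi> span the algebra and
      commute.\<close>
    case True
    have "card {a, b} = card E" using \<open>a \<noteq> b\<close> True by simp
    then have "E = {a, b}" using card_subset_eq[OF fin E(1)] by simp
    then show ?thesis
      using e br_lee_\<xi> br_skew[of \<xi> lee] by (auto simp: a_def b_def br_simps alternating)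
  next
    case False
    let ?D = "derived_series br 1"
    have D: "subspace ?D" by (rule subspace_derived_series)
    have "br x y \<in> ?D" for x y
      using br_derived_series[of x 0 y] by simp
    then have "(\<Sum>e\<in>E. br e (J e)) \<in> ?D"
      by (intro subspace_sum[OF D])
    then have "inverse (real (card E) - 2) *\<^sub>R (real (card E) - 2) *\<^sub>R \<xi> \<in> ?D"
      unfolding sum_br_J[OF uni onb] \<xi>_def[symmetric] by (rule subspace_scale[OF D])
    moreover have "real (card E) - 2 \<noteq> 0" using False by simp
    ultimately have "\<xi> \<in> ?D" by simp
    then have "(\<Sum>e\<in>E. ip (br \<xi> (br \<xi> e)) e) = 0"
      using trace_derived_eq_0[OF solv, of \<xi> \<xi>]
        op_trace_onb[OF linear_compose[OF linear_br linear_br] onb, of \<xi> \<xi>] by (simp add: o_def)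
    then have "(\<Sum>e\<in>E. ip (br \<xi> e) (br \<xi> e)) = 0"
      using br_\<xi>_skew[of "br \<xi> _"] by (simp add: sum_negf)
    then show ?thesis
      using e fin by (simp add: sum_nonneg_eq_0_iff ip_nonneg)
  qed
  then show ?thesis
    using linear_eq_0_on_span[OF linear_br, of E \<xi> x] E(3) by simp
qed

lemma br_\<xi>_right: "br x \<xi> = 0"
  using \<xi>_central[of x] br_skew[of x \<xi>] by simp

section \<open>The quotient by the central line\<close>

definition drop_\<xi> :: "'a \<Rightarrow> 'a" where
  "drop_\<xi> x = x - (ip \<xi> x / lee_sq) *\<^sub>R \<xi>"

lemma linear_drop_\<xi>: "linear drop_\<xi>"
  unfolding drop_\<xi>_def by (rule linearI) (simp_all add: ip_simps algebra_simps add_divide_distrib)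

lemma br_drop_\<xi> [simp]: "br x (drop_\<xi> y) = br x y" "br (drop_\<xi> x) y = br x y"
  by (simp_all add: drop_\<xi>_def br_simps \<xi>_central br_\<xi>_right)

lemma drop_\<xi>_eq_0: "drop_\<xi> x = 0 \<Longrightarrow> br y x = 0"
  using br_drop_\<xi>(1)[of y x] by (simp add: br_simps)

text \<open>
  The quotient by the central line \<open>\<real>\<xi>\<close>, with a trivial factor \<open>\<real>\<xi>\<close> added back so that
  \<open>J\<close> and the inner product can be kept; it is Kaehler.
\<close>

definition brK :: "'a \<Rightarrow> 'a \<Rightarrow> 'a" where
  "brK x y = drop_\<xi> (br x y)"

lemma real_lie_algebra_brK: "real_lie_algebra brK"
proof
  show "finite_dim TYPE('a)" by (rule fd)
  show "bilinear brK"
    unfolding bilinear_def brK_def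
    using linear_compose[OF linear_br linear_drop_\<xi>] linear_compose[OF linear_br_left linear_drop_\<xi>]
    by (simp add: o_def)
  show "brK x x = 0" for x
    by (simp add: brK_def alternating linear_0[OF linear_drop_\<xi>])
  show "brK x (brK y z) + brK y (brK z x) + brK z (brK x y) = 0" for x y z
    using jacobi[of x y z] by (simp add: brK_def linear_0[OF linear_drop_\<xi>] flip: linear_add[OF linear_drop_\<xi>])
qed

text \<open>By \<open>ip_\<xi>_br\<close> the removed coefficient \<open>c\<close> is \<omega> plus
  a multiple of the wedge of \<theta> with the dual form of \<xi>. Both parts are J-invariant, so
  integrability survives. Removing \<open>c x y *\<^sub>R \<xi>\<close> subtracts the wedge of
  \<theta> with \<open>c\<close> from d\<omega>; this equals the wedge of \<theta> with \<omega>, so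
  nothing remains.\<close>

lemma lck_brK: "lck_structure brK J ip (\<lambda>_. 0)"
proof -
  define c where "c x y = ip \<xi> (br x y) / lee_sq" for x y
  have c: "c x y = ip (J x) y + (\<theta> y * ip \<xi> x - \<theta> x * ip \<xi> y) / lee_sq" for x y
    using lee_sq_pos ip_\<xi>_br[of x y] by (simp add: c_def field_simps)
  have c1: "c (J x) (J y) = c x y" for x y
    using ip_J_right[of x y] by (simp add: c ip_simps \<theta>_J ip_\<xi>_J field_simps)
  have c2: "c (J x) y + c x (J y) = 0" for x y
    by (simp add: c ip_simps \<theta>_J ip_\<xi>_J algebra_simps add_divide_distrib diff_divide_distrib)
  have brK: "brK x y = br x y - c x y *\<^sub>R \<xi>" for x y
    by (simp add: brK_def drop_\<xi>_def c_def)
  have N: "brK (J x) (J y) - brK x y - J (brK (J x) y + brK x (J y)) = 0" for x y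
  proof -
    have "brK (J x) (J y) - brK x y - J (brK (J x) y + brK x (J y)) =
      (br (J x) (J y) - br x y - J (br (J x) y) - J (br x (J y)))
      - (c (J x) (J y) - c x y) *\<^sub>R \<xi> + (c (J x) y + c x (J y)) *\<^sub>R J \<xi>"
      by (simp add: brK J_simps algebra_simps)
    then show ?thesis
      unfolding c1 c2 nijenhuis by simp
  qed
  have \<omega>: "- ip (J (brK x y)) z + ip (J (brK x z)) y - ip (J (brK y z)) x = 0" for x y z
  proof -
    have "- ip (J (brK x y)) z + ip (J (brK x z)) y - ip (J (brK y z)) x
      = (- ip (J (br x y)) z + ip (J (br x z)) y - ip (J (br y z)) x)
        - c x y * \<theta> z + c x z * \<theta> y - c y z * \<theta> x"
      by (simp add: brK J_simps ip_simps J_\<xi> ip_lee algebra_simps)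
    also have "\<dots> = 0"
      unfolding d_\<omega> c using lee_sq_pos by (simp add: field_simps)
    finally show ?thesis .
  qed
  show ?thesis
    using lck N \<omega>
    by (simp add: lck_structure_def complex_structure_def ce_d1_def ce_d2_def wedge12_def
        fundamental_form_def linear_zero)
qed

lemma unimodular_brK: "unimodular brK"
  unfolding unimodular_def
proof
  fix x
  obtain E where E: "onb E" by (rule onb_exists)
  have "linear (brK x)"
    unfolding brK_def using linear_compose[OF linear_br linear_drop_\<xi>] by (simp add: o_def)
  then have "op_trace (brK x) = (\<Sum>e\<in>E. ip (brK x e) e)"
    by (rule op_trace_onb[OF _ E])
  also have "\<dots> = (\<Sum>e\<in>E. ip (br x e) e) - (\<Sum>e\<in>E. ip \<xi> e * ip \<xi> (br x e)) / lee_sq"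
    by (simp add: brK_def drop_\<xi>_def ip_simps sum_subtractf sum_divide_distrib mult.commute)
  also have "(\<Sum>e\<in>E. ip \<xi> e * ip \<xi> (br x e)) = ip \<xi> (br x (\<Sum>e\<in>E. ip \<xi> e *\<^sub>R e))"
    by (simp add: linear_sum[OF linear_br] linear_sum[OF linear_ip] br_simps ip_simps)
  also have "\<dots> = 0"
    by (simp add: onb_expand[OF E] br_\<xi>_right ip_simps)
  finally show "op_trace (brK x) = 0"
    by (simp add: trace_br[OF uni E])
qed

lemma solvable_brK: "solvable brK"
proof -
  \<comment> \<open>\<open>drop_\<xi>\<close> is a homomorphism from \<open>br\<close> to
    \<open>brK\<close>. The inclusion starts at index 1, since at index 0 the whole space is not
    contained in the image of \<open>drop_\<xi>\<close>.\<close>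
  have sub: "derived_series brK (Suc n) \<subseteq> drop_\<xi> ` derived_series br (Suc n)" for n
  proof (induction n)
    case 0
    have "{brK x y |x y. x \<in> UNIV \<and> y \<in> UNIV} = drop_\<xi> ` {br x y |x y. x \<in> UNIV \<and> y \<in> UNIV}"
      by (auto simp: brK_def)
    then show ?case
      by (simp add: linear_span_image[OF linear_drop_\<xi>])
  next
    case (Suc n)
    have "brK x y \<in> drop_\<xi> ` derived_series br (Suc (Suc n))"
      if xy: "x \<in> derived_series brK (Suc n)" "y \<in> derived_series brK (Suc n)" for x y
    proof -
      obtain a b where ab: "x = drop_\<xi> a" "a \<in> derived_series br (Suc n)"
        "y = drop_\<xi> b" "b \<in> derived_series br (Suc n)"
        using Suc.IH xy by blast
      have "br a b \<in> derived_series br (Suc (Suc n))"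
        by (rule br_derived_series[OF ab(2,4)])
      then show ?thesis by (simp only: ab(1,3) brK_def br_drop_\<xi> imageI)
    qed
    then have "{brK x y |x y. x \<in> derived_series brK (Suc n) \<and> y \<in> derived_series brK (Suc n)}
        \<subseteq> drop_\<xi> ` derived_series br (Suc (Suc n))"
      by blast
    then have "span {brK x y |x y. x \<in> derived_series brK (Suc n) \<and> y \<in> derived_series brK (Suc n)}
        \<subseteq> drop_\<xi> ` derived_series br (Suc (Suc n))"
      by (rule span_minimal[OF _ linear_subspace_image[OF linear_drop_\<xi> subspace_derived_series]])
    then show ?case
      by (simp only: derived_series.simps(2)[of brK "Suc n"])
  qed
  obtain m where m: "derived_series br m = {0}"
    using solv by (auto simp: solvable_def)
  interpret K: real_lie_algebra brK by (rule real_lie_algebra_brK)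
  have "derived_series brK (Suc m) \<subseteq> drop_\<xi> ` derived_series br m"
    using sub[of m] derived_series_Suc_subset[of m] by blast
  then have "derived_series brK (Suc m) \<subseteq> {0}"
    unfolding m by (simp only: image_insert image_empty linear_0[OF linear_drop_\<xi>])
  moreover have "0 \<in> derived_series brK (Suc m)"
    by (rule subspace_0[OF K.subspace_derived_series])
  ultimately show ?thesis unfolding solvable_def by blast
qed

lemma real_part_eq_0:
  assumes ev: "complex_eigenvalue (br x) \<mu>"
  shows "Re \<mu> = 0"
proof (rule ccontr)
  assume \<mu>: "Re \<mu> \<noteq> 0"
  interpret K: real_lie_algebra brK by (rule real_lie_algebra_brK)
  interpret K: kaehler_lie brK ip J
    by unfold_locales (rule inner lck_brK)+
  obtain p q where pq: "p \<noteq> 0 \<or> q \<noteq> 0" "br x p = Re \<mu> *\<^sub>R p - Im \<mu> *\<^sub>R q"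
    "br x q = Re \<mu> *\<^sub>R q + Im \<mu> *\<^sub>R p"
    using ev unfolding complex_eigenvalue_iff by blast
  have "brK x (drop_\<xi> p) = Re \<mu> *\<^sub>R drop_\<xi> p - Im \<mu> *\<^sub>R drop_\<xi> q" "brK x (drop_\<xi> q) = Re \<mu> *\<^sub>R drop_\<xi> q + Im \<mu> *\<^sub>R drop_\<xi> p"
    by (simp_all add: brK_def pq linear_diff[OF linear_drop_\<xi>] linear_add[OF linear_drop_\<xi>]
        linear_scale[OF linear_drop_\<xi>])
  \<comment> \<open>An eigenvector inside the complexified line of \<xi> would be killed by
    \<open>br x\<close>, which a nonzero eigenvalue excludes.\<close>
  moreover have "drop_\<xi> p \<noteq> 0 \<or> drop_\<xi> q \<noteq> 0"
  proof (rule ccontr)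
    assume "\<not> ?thesis"
    then have "br x p = 0" "br x q = 0" using drop_\<xi>_eq_0 by auto
    moreover have "(Re \<mu>)\<^sup>2 + (Im \<mu>)\<^sup>2 \<noteq> 0"
      using \<mu> by (simp add: sum_power2_eq_zero_iff)
    ultimately have "p = 0" "q = 0"
      using complex_eigenvector_norm[OF pq(2,3)] by auto
    then show False using pq(1) by simp
  qed
  ultimately have "complex_eigenvalue (brK x) \<mu>"
    unfolding complex_eigenvalue_iff by blast
  then show False
    using K.imaginary_eigenvalues[OF unimodular_brK solvable_brK] \<mu> by blast
qed

lemma zero_eigenvalue: "complex_eigenvalue (br x) 0"
proof -
  have "\<xi> \<noteq> 0" using \<xi>_norm lee_sq_pos by (auto simp: ip_simps)
  then show ?thesis
    unfolding complex_eigenvalue_iff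
    by (intro exI[of _ \<xi>] exI[of _ 0]) (simp add: br_\<xi>_right br_simps)
qed

end

theorem theorem5p3:
  fixes br :: "'a::real_vector \<Rightarrow> 'a \<Rightarrow> 'a"
  assumes "real_lie_algebra br"
    and "unimodular br"
    and "solvable br"
    and "\<exists>J ip. vaisman_structure br J ip"
  shows "\<forall>x. (\<forall>\<mu>. complex_eigenvalue (br x) \<mu> \<longrightarrow> Re \<mu> = 0) \<and> complex_eigenvalue (br x) 0"
proof -
  obtain J ip \<theta> where "lck_structure br J ip \<theta>" "\<forall>x y. nabla_form br ip \<theta> x y = 0" "\<exists>x. \<theta> x \<noteq> 0"
    using assms(4) by (auto simp: vaisman_structure_def)
  moreover from this(1) have "inner_product ip"
    by (simp add: lck_structure_def hermitian_def)
  ultimately have "vaisman_lie br ip J \<theta>"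
    using assms(1-3)
    by (simp add: vaisman_lie_def vaisman_lie_axioms_def lck_lie_def lck_lie_axioms_def
        lie_inner_def lie_inner_axioms_def)
  then interpret vaisman_lie br ip J \<theta> .
  show ?thesis
    using real_part_eq_0 zero_eigenvalue by blast
qed

end
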